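(* Let $A$ be a real symmetric $n\times n$ matrix with rank $r(A)\ge3$, eigenvalues $\lambda_1,\dots,\lambda_n$ (with multiplicity) and largest eigenvalue $\lambda_{\max}(A)>0$. Let $1\le k\le n-1$ be such that $\lambda_1\le\cdots\le\lambda_k<0$ are the $k$ smallest eigenvalues of $A$, and suppose $r(A)-k$ is even. Let $\underline{\boldsymbol{x}}\sim N(\underline 0,I_n)$ and $\boldsymbol{\Delta}=\underline{\boldsymbol{x}}^{\mathsf T}A\underline{\boldsymbol{x}}-\mathrm{tr}(A)$. If $t>0$ satisfies $t+\mathrm{tr}(A)\ge0$, then $$\Pr(\boldsymbol{\Delta}>t)\le e^{-\frac{t+\mathrm{tr}(A)}{2\lambda_{\max}(A)}}\sum_{m=0}^{\frac{r(A)-k}{2}-1}\frac{1}{2^m}\sum_{l=0}^m\frac{\tilde c_{k,l}}{(m-l)!}\Big(\frac{t+\mathrm{tr}(A)}{\lambda_{\max}(A)}\Big)^{m-l},$$ where $$\tilde c_{k,l}=\frac{1}{\prod_{i=1}^k\big(\frac{-\lambda_i}{\lambda_{\max}(A)}+1\big)^{\frac12}}\sum_{\substack{j_1,\dots,j_k\ge0\\ j_1+\cdots+j_k=l}}\ \prod_{i=1}^k\frac{(2j_i-1)!!}{j_i!}\tilde\phi_i^{j_i},\qquad\tilde\phi_i=\frac{\frac{-\lambda_i}{\lambda_{\max}(A)}}{\frac{-\lambda_i}{\lambda_{\max}(A)}+1}.$$ Moreover, the numbers $\tilde c_{k,l}$ satisfy the recursion $$\tilde c_{k,0}=\frac{1}{\prod_{i=1}^k\big(\frac{-\lambda_i}{\lambda_{\max}(A)}+1\big)^{\frac12}},\qquad\tilde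 c_{k,l}=\frac{1}{2l}\sum_{j=0}^{l-1}\tilde d_{k,l-j}\,\tilde c_{k,j},\quad l\ge1,$$ where $\tilde d_{k,l}=\sum_{i=1}^k(2\tilde\phi_i)^l$ for $l\ge1$.
   Context: Conventions: $(2j-1)!!=1$ for $j=0$ and $(2j-1)!!=1\cdot3\cdot5\cdots(2j-1)$ for $j\ge1$; $0^0=1$. The indices $j_1,\dots,j_k$ are nonnegative integers. *)

theory Defs
  imports "HOL-Probability.Probability"
    "HOL-Computational_Algebra.Computational_Algebra"
begin

definition mat_char_poly :: "real^'n^'n \<Rightarrow> real poly" where
  "mat_char_poly A = det (mat [:0, 1:] - map_matrix (\<lambda>a. [:a:]) A)"

(* The multiset of real eigenvalues, each counted with its algebraic multiplicity
   (for a symmetric matrix this has CARD('n) elements). *)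
definition mat_eigenvalues :: "real^'n^'n \<Rightarrow> real multiset" where
  "mat_eigenvalues A = proots (mat_char_poly A)"

definition lambda_max :: "real^'n^'n \<Rightarrow> real" where
  "lambda_max A = Max (set_mset (mat_eigenvalues A))"

(* N(0, I_n): the joint density is the product of one-dimensional N(0,1) densities. *)
definition std_normal_vector :: "'w measure \<Rightarrow> ('w \<Rightarrow> real^'n) \<Rightarrow> bool" where
  "std_normal_vector M x \<longleftrightarrow>
     distributed M lborel x (\<lambda>v. ennreal (\<Prod>i\<in>UNIV. std_normal_density (v $ i)))"

(* (2j-1)!!, with value 1 at j = 0 *)
definition odd_double_fact :: "nat \<Rightarrow> nat" where
  "odd_double_fact j = (\<Prod>i=1..j. 2 * i - 1)"

definition phi_tilde :: "real \<Rightarrow> (nat \<Rightarrow> real) \<Rightarrow> nat \<Rightarrow> real" where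
  "phi_tilde L lam i = (- lam i / L) / (- lam i / L + 1)"

(* Extensional functions on {1..k} represent the tuples (j_1, ..., j_k). *)
definition index_tuples :: "nat \<Rightarrow> nat \<Rightarrow> (nat \<Rightarrow> nat) set" where
  "index_tuples k l = {j \<in> {1..k} \<rightarrow>\<^sub>E UNIV. (\<Sum>i=1..k. j i) = l}"

lemma finite_index_tuples: "finite (index_tuples k l)"
proof (rule finite_subset)
  show "index_tuples k l \<subseteq> {1..k} \<rightarrow>\<^sub>E {0..l}"
  proof
    fix j assume j: "j \<in> index_tuples k l"
    have "j i \<le> l" if "i \<in> {1..k}" for i
      using j that member_le_sum[of i "{1..k}" j] by (auto simp: index_tuples_def)
    with j show "j \<in> {1..k} \<rightarrow>\<^sub>E {0..l}"
      by (auto simp: index_tuples_def PiE_def Pi_def)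
  qed
  show "finite ({1..k} \<rightarrow>\<^sub>E {0..l})"
    by (intro finite_PiE) auto
qed

definition c_tilde :: "real \<Rightarrow> (nat \<Rightarrow> real) \<Rightarrow> nat \<Rightarrow> nat \<Rightarrow> real" where
  "c_tilde L lam k l =
     1 / (\<Prod>i=1..k. (- lam i / L + 1) powr (1 / 2)) *
     (\<Sum>j\<in>index_tuples k l.
        \<Prod>i=1..k. real (odd_double_fact (j i)) / fact (j i) * phi_tilde L lam i ^ j i)"

definition d_tilde :: "real \<Rightarrow> (nat \<Rightarrow> real) \<Rightarrow> nat \<Rightarrow> nat \<Rightarrow> real" where
  "d_tilde L lam k l = (\<Sum>i=1..k. (2 * phi_tilde L lam i) ^ l)"

end

theory Submission
  imports Defs
begin

text \<open>
  Expand \<open>x\<close> in an orthonormal eigenbasis of \<open>A\<close>. By rotation invariance the coordinates \<open>y\<^sub>i\<close> are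
  independent standard normal variables (\<open>indep_vars_std_normal_coordinates\<close>), and the quadratic
  form is the sum of \<open>lam i * y\<^sub>i\<^sup>2\<close>. Write \<open>L\<close> for the largest eigenvalue. The zero eigenvalues
  contribute nothing; raising to \<open>L\<close> every nonzero eigenvalue beyond the first \<open>k\<close> bounds the form by
  \<open>L * (U - W)\<close>. Here \<open>U\<close> is the sum of the \<open>2 p = rank A - k\<close> corresponding \<open>y\<^sub>i\<^sup>2\<close>, and \<open>W\<close>, the sum of
  the \<open>(- lam i / L) * y\<^sub>i\<^sup>2\<close> over \<open>i \<le> k\<close>, is nonnegative and independent of \<open>U\<close>. With
  \<open>s = (t + trace A) / L\<close> the probability is therefore at most that of \<open>U > s + W\<close>.

  That probability is computed exactly. As \<open>U\<close> is chi-square distributed with an even number of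
  degrees of freedom, its tail is the finite sum \<open>exp (- u / 2) * (\<Sum>m<p. (u / 2) ^ m / fact m)\<close>
  (\<open>chi_square_even_tail\<close>, from the volume of balls). Put \<open>u = s + W\<close>, expand by the binomial
  theorem and average over \<open>W\<close>. The expectations that appear are those of
  \<open>exp (- W / 2) * W ^ l / fact l\<close>, and these are the numbers \<open>c_tilde\<close>
  (\<open>c_tilde_eq_expectation\<close>): a Gaussian moment computation for each coordinate, combined by the
  multinomial theorem.

  The recursion comes from the generating function of \<open>c_tilde\<close>, which up to a constant is the
  product of the series \<open>(1 - 2 \<phi>\<^sub>i X) powr (- 1 / 2)\<close>. Its logarithmic derivative is half of the
  sum over \<open>l \<ge> 1\<close> of \<open>d_tilde L lam k l * X ^ (l - 1)\<close>.
\<close>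

section \<open>Orthonormal eigenbases of symmetric matrices\<close>

lemma nonneg_quadratic_imp_zero_linear:
  fixes a b :: real
  assumes "\<And>t. 0 \<le> 2 * t * b + t\<^sup>2 * a"
  shows "b = 0"
proof (rule ccontr)
  assume "b \<noteq> 0"
  \<comment> \<open>For this \<open>t\<close> the linear term is negative and outweighs the quadratic one.\<close>
  define t where "t = - b / (\<bar>a\<bar> + 1)"
  have pos: "\<bar>a\<bar> + 1 > 0" by simp
  have "t\<^sup>2 * a \<le> t\<^sup>2 * (\<bar>a\<bar> + 1)"
    by (intro mult_left_mono) auto
  also have "t\<^sup>2 * (\<bar>a\<bar> + 1) = - t * b"
    using pos unfolding t_def power2_eq_square by (simp add: add_nonneg_eq_0_iff)
  finally have "2 * t * b + t\<^sup>2 * a \<le> t * b" by linarith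
  also have "t * b = - (b\<^sup>2 / (\<bar>a\<bar> + 1))"
    unfolding t_def by (simp add: power2_eq_square)
  also have "\<dots> < 0" using \<open>b \<noteq> 0\<close> pos by simp
  finally show False using assms[of t] by simp
qed

text \<open>
  A maximizer \<open>v\<close> of the Rayleigh quotient on the unit sphere of \<open>S\<close> is an eigenvector: with the
  maximum \<open>c\<close>, the form \<open>c |u|\<^sup>2 - u \<bullet> f u\<close> is nonnegative on \<open>S\<close> and vanishes at \<open>v\<close>, so its
  derivative at \<open>v\<close> vanishes in every direction of \<open>S\<close>. One of these directions is the
  residual \<open>c v - f v\<close> itself, because \<open>S\<close> is invariant.
\<close>
lemma selfadjoint_eigenvector_in_subspace:
  fixes f :: "'a::euclidean_space \<Rightarrow> 'a"
  assumes lin: "linear f" and sa: "\<And>x y. f x \<bullet> y = x \<bullet> f y"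
    and S: "subspace S" "f ` S \<subseteq> S" "S \<noteq> {0}"
  obtains v c where "v \<in> S" "norm v = 1" "f v = c *\<^sub>R v"
proof -
  have cont: "continuous_on T (\<lambda>x. x \<bullet> f x)" for T
    by (intro continuous_intros linear_continuous_on linear_conv_bounded_linear[THEN iffD1] lin)
  have "compact (S \<inter> sphere 0 1)"
    by (rule closed_Int_compact[OF closed_subspace[OF S(1)]]) auto
  moreover have "S \<inter> sphere 0 1 \<noteq> {}"
  proof -
    obtain u where "u \<in> S" "u \<noteq> 0" using S subspace_0 by blast
    then have "(1 / norm u) *\<^sub>R u \<in> S \<inter> sphere 0 1"
      using S(1) by (auto simp: subspace_scale)
    then show ?thesis by blast
  qed
  ultimately obtain v where "v \<in> S \<inter> sphere 0 1"
    and "\<forall>y\<in>S \<inter> sphere 0 1. y \<bullet> f y \<le> v \<bullet> f v"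
    using continuous_attains_sup[OF _ _ cont] by blast
  then have v: "v \<in> S" "norm v = 1"
    and max: "\<And>y. y \<in> S \<Longrightarrow> norm y = 1 \<Longrightarrow> y \<bullet> f y \<le> v \<bullet> f v"
    by auto
  define c where "c = v \<bullet> f v"
  have bound: "u \<bullet> f u \<le> c * (u \<bullet> u)" if "u \<in> S" for u
  proof (cases "u = 0")
    case False
    have "((1 / norm u) *\<^sub>R u) \<bullet> f ((1 / norm u) *\<^sub>R u) \<le> c"
      unfolding c_def using that False S(1) by (intro max) (auto simp: subspace_scale)
    then show ?thesis
      using False by (simp add: linear_cmul[OF lin] field_simps dot_square_norm power2_eq_square)
  qed (use linear_0[OF lin] in auto)
  define w where "w = c *\<^sub>R v - f v"
  have wS: "w \<in> S"
    unfolding w_def using v S by (auto intro!: subspace_diff subspace_scale)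
  have vv: "v \<bullet> v = 1" using v by (simp add: dot_square_norm)
  have "w \<bullet> w = 0"
  proof (rule nonneg_quadratic_imp_zero_linear)
    fix t :: real
    have "v + t *\<^sub>R w \<in> S" using v wS S by (auto intro!: subspace_add subspace_scale)
    from bound[OF this]
    have "0 \<le> c * ((v + t *\<^sub>R w) \<bullet> (v + t *\<^sub>R w)) - (v + t *\<^sub>R w) \<bullet> f (v + t *\<^sub>R w)" by simp
    also have "\<dots> = 2 * t * (w \<bullet> w) + t\<^sup>2 * (c * (w \<bullet> w) - w \<bullet> f w)"
    proof -
      have "v \<bullet> f w = w \<bullet> f v" using sa[of v w] by (simp add: inner_commute)
      then have "c * ((v + t *\<^sub>R w) \<bullet> (v + t *\<^sub>R w)) - (v + t *\<^sub>R w) \<bullet> f (v + t *\<^sub>R w)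
          = 2 * t * (c * (v \<bullet> w) - w \<bullet> f v) + t\<^sup>2 * (c * (w \<bullet> w) - w \<bullet> f w)"
        using vv by (simp add: linear_add[OF lin] linear_cmul[OF lin] c_def inner_commute
            algebra_simps power2_eq_square)
      moreover have "c * (v \<bullet> w) - w \<bullet> f v = w \<bullet> w"
        by (subst (3) w_def) (simp add: algebra_simps inner_commute)
      ultimately show ?thesis by simp
    qed
    finally show "0 \<le> 2 * t * (w \<bullet> w) + t\<^sup>2 * (c * (w \<bullet> w) - w \<bullet> f w)" .
  qed
  then have "f v = c *\<^sub>R v" by (simp add: w_def)
  with v that show thesis by blast
qed

text \<open>
  Induction on the dimension: the orthogonal complement, within \<open>S\<close>, of one eigenvector is again
  invariant, by self-adjointness.
\<close>
lemma selfadjoint_orthonormal_eigenbasis: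
  fixes f :: "'a::euclidean_space \<Rightarrow> 'a"
  assumes lin: "linear f" and sa: "\<And>x y. f x \<bullet> y = x \<bullet> f y"
    and S: "subspace S" "f ` S \<subseteq> S"
  shows "\<exists>B \<subseteq> S. finite B \<and> card B = dim S \<and> pairwise orthogonal B \<and>
    (\<forall>v\<in>B. norm v = 1 \<and> (\<exists>c. f v = c *\<^sub>R v))"
  using S
proof (induction "dim S" arbitrary: S)
  case 0
  then show ?case by (intro exI[of _ "{}"]) auto
next
  case (Suc n)
  then have "S \<noteq> {0}" by auto
  with Suc.prems obtain v c where v: "v \<in> S" "norm v = 1" "f v = c *\<^sub>R v"
    using selfadjoint_eigenvector_in_subspace[OF lin sa] by metis
  define T where "T = {y \<in> S. \<forall>x\<in>span {v}. orthogonal x y}"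
  have T_alt: "T = {y \<in> S. v \<bullet> y = 0}"
    by (auto simp: T_def span_singleton orthogonal_def)
  have "subspace T"
    using Suc.prems(1) unfolding T_alt subspace_def by (auto simp: inner_add_right)
  have "f ` T \<subseteq> T"
  proof safe
    fix y assume "y \<in> T"
    then have "v \<bullet> f y = 0" using sa[of v y] v(3) by (simp add: T_alt)
    then show "f y \<in> T" using \<open>y \<in> T\<close> Suc.prems(2) by (auto simp: T_alt)
  qed
  have "v \<noteq> 0" using v by auto
  have "span {v} \<subseteq> S" using Suc.prems(1) v(1) by (intro span_minimal) auto
  then have "dim T + dim (span {v}) = dim S"
    unfolding T_def using Suc.prems(1)
    by (intro dim_subspace_orthogonal_to_vectors subspace_span)
  moreover have "dim (span {v}) = 1" using \<open>v \<noteq> 0\<close> by (simp add: dim_singleton)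
  ultimately have "n = dim T" using Suc.hyps(2) by simp
  from Suc.hyps(1)[OF this \<open>subspace T\<close> \<open>f ` T \<subseteq> T\<close>] obtain B where B: "B \<subseteq> T" "finite B"
    "card B = dim T" "pairwise orthogonal B" "\<forall>v\<in>B. norm v = 1 \<and> (\<exists>c. f v = c *\<^sub>R v)" by blast
  have "v \<notin> B" using B(1) v(2) by (auto simp: T_alt dot_square_norm)
  show ?case
  proof (intro exI[of _ "insert v B"] conjI)
    show "card (insert v B) = dim S" using B \<open>v \<notin> B\<close> Suc.hyps(2) \<open>n = dim T\<close> by simp
    show "pairwise orthogonal (insert v B)"
      using B(1,4) by (auto simp: pairwise_insert T_alt orthogonal_def inner_commute)
  qed (use B v T_alt in auto)
qed

lemma symmetric_matrix_orthonormal_eigenbasis: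
  fixes A :: "real^'n^'n"
  assumes "transpose A = A"
  obtains b :: "'n \<Rightarrow> real^'n" and \<mu> where
    "\<And>i j. b i \<bullet> b j = (if i = j then 1 else 0)" "\<And>i. A *v b i = \<mu> i *\<^sub>R b i"
proof -
  have "\<exists>B \<subseteq> (UNIV :: (real^'n) set). finite B \<and> card B = dim (UNIV :: (real^'n) set) \<and>
    pairwise orthogonal B \<and> (\<forall>v\<in>B. norm v = 1 \<and> (\<exists>c. A *v v = c *\<^sub>R v))"
  proof (rule selfadjoint_orthonormal_eigenbasis)
    show "(A *v x) \<bullet> y = x \<bullet> (A *v y)" for x y
      using assms by (metis dot_lmul_matrix vector_transpose_matrix)
  qed auto
  then obtain B :: "(real^'n) set" where B: "finite B" "card B = CARD('n)" "pairwise orthogonal B"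
    "\<And>v. v \<in> B \<Longrightarrow> norm v = 1" "\<And>v. v \<in> B \<Longrightarrow> \<exists>c. A *v v = c *\<^sub>R v"
    by auto
  then obtain b where b: "bij_betw b (UNIV::'n set) B"
    by (metis finite_class.finite_UNIV finite_same_card_bij)
  then have bB: "b i \<in> B" for i by (auto simp: bij_betw_def)
  obtain \<mu> where "\<And>i. A *v b i = \<mu> i *\<^sub>R b i" using B(5)[OF bB] by metis
  moreover have "b i \<bullet> b j = (if i = j then 1 else 0)" for i j
  proof -
    have "i \<noteq> j \<Longrightarrow> b i \<noteq> b j" using b by (auto simp: bij_betw_def inj_on_def)
    then show ?thesis
      using B(3) B(4)[OF bB] bB by (auto simp: pairwise_def orthogonal_def dot_square_norm)
  qed
  ultimately show thesis using that by blast
qed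

definition column_matrix :: "('n \<Rightarrow> real^'n) \<Rightarrow> real^'n^'n" where
  "column_matrix b = (\<chi> i j. b j $ i)"

context
  fixes b :: "'n::finite \<Rightarrow> real^'n"
  assumes orthonormal: "\<And>i j. b i \<bullet> b j = (if i = j then 1 else 0)"
begin

lemma transpose_column_matrix_mult: "transpose (column_matrix b) ** column_matrix b = mat 1"
  using orthonormal
  by (simp add: vec_eq_iff matrix_matrix_mult_def transpose_def column_matrix_def mat_def inner_vec_def)

lemma orthonormal_expansion: "x = (\<Sum>i\<in>UNIV. (x \<bullet> b i) *\<^sub>R b i)"
proof -
  have "column_matrix b ** transpose (column_matrix b) = mat 1"
    using transpose_column_matrix_mult matrix_left_right_inverse by blast
  then have "x = column_matrix b *v (transpose (column_matrix b) *v x)"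
    by (simp add: matrix_vector_mul_assoc del: transpose_matrix_vector)
  also have "\<dots> = (\<Sum>i\<in>UNIV. (x \<bullet> b i) *\<^sub>R b i)"
    by (simp add: vec_eq_iff matrix_vector_mult_def transpose_def column_matrix_def inner_vec_def
        mult.commute del: transpose_matrix_vector)
  finally show ?thesis .
qed

text \<open>
  This is what makes the coordinates of a Gaussian vector with respect to \<open>b\<close> again Gaussian.
\<close>
lemma orthogonal_transformation_coordinates: "orthogonal_transformation (\<lambda>x. \<chi> i. x \<bullet> b i)"
  unfolding orthogonal_transformation_def
proof (intro conjI allI)
  show "linear (\<lambda>x. \<chi> i. x \<bullet> b i)"
    by (intro linearI) (auto simp: vec_eq_iff inner_add_left)
  show "(\<chi> i. v \<bullet> b i) \<bullet> (\<chi> i. w \<bullet> b i) = v \<bullet> w" for v w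
  proof -
    have "v \<bullet> w = (\<Sum>i\<in>UNIV. (v \<bullet> b i) * (w \<bullet> b i))"
      by (subst (1) orthonormal_expansion[of w]) (simp add: inner_sum_right mult.commute)
    then show ?thesis by (subst inner_vec_def) simp
  qed
qed

context
  fixes A :: "real^'n^'n" and \<mu> :: "'n \<Rightarrow> real"
  assumes eigen: "\<And>i. A *v b i = \<mu> i *\<^sub>R b i"
begin

lemma matrix_apply_eigenbasis: "A *v x = (\<Sum>i\<in>UNIV. (\<mu> i * (x \<bullet> b i)) *\<^sub>R b i)"
  by (subst orthonormal_expansion[of x])
     (simp add: linear_sum[OF matrix_vector_mul_linear] linear_cmul[OF matrix_vector_mul_linear]
        eigen mult.commute)

lemma quadratic_form_eigenbasis: "x \<bullet> (A *v x) = (\<Sum>i\<in>UNIV. \<mu> i * (x \<bullet> b i)\<^sup>2)"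
  by (subst matrix_apply_eigenbasis)
     (simp add: inner_sum_right power2_eq_square mult_ac)

lemma rank_eq_card_nonzero_eigenvalues: "rank A = card {i. \<mu> i \<noteq> 0}"
proof -
  let ?N = "{i. \<mu> i \<noteq> 0}"
  have inj: "inj b"
    by (rule injI) (metis orthonormal zero_neq_one)
  have span: "span (b ` ?N) = range (\<lambda>x. A *v x)"
  proof
    have "b i \<in> range (\<lambda>x. A *v x)" if "\<mu> i \<noteq> 0" for i
      using that by (intro image_eqI[of _ _ "(1 / \<mu> i) *\<^sub>R b i"])
        (auto simp: linear_cmul[OF matrix_vector_mul_linear] eigen)
    moreover have "subspace (range (\<lambda>x. A *v x))"
      by (intro linear_subspace_image subspace_UNIV) auto
    ultimately show "span (b ` ?N) \<subseteq> range (\<lambda>x. A *v x)"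
      by (intro span_minimal) auto
    show "range (\<lambda>x. A *v x) \<subseteq> span (b ` ?N)"
    proof safe
      fix x
      have "(\<mu> i * (x \<bullet> b i)) *\<^sub>R b i \<in> span (b ` ?N)" for i
        by (cases "\<mu> i = 0") (auto intro: span_base span_scale simp: span_zero)
      then show "A *v x \<in> span (b ` ?N)"
        by (subst matrix_apply_eigenbasis) (intro span_sum)
    qed
  qed
  have "independent (b ` ?N)"
  proof (rule pairwise_orthogonal_independent)
    show "pairwise orthogonal (b ` ?N)"
      using orthonormal by (auto simp: pairwise_def orthogonal_def)
    show "0 \<notin> b ` ?N" using orthonormal by (metis imageE inner_zero_left zero_neq_one)
  qed
  then have "dim (b ` ?N) = card ?N"
    by (simp add: dim_eq_card_independent card_image inj_on_subset[OF inj])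
  then show ?thesis by (metis dim_span rank_dim_range span)
qed

text \<open>
  The relation \<open>A b\<^sub>j = \<mu>\<^sub>j b\<^sub>j\<close> holds columnwise also over the polynomial ring:
  \<open>(X - A) P = P D\<close> with \<open>P\<close> the matrix of constant polynomials with columns \<open>b\<^sub>j\<close> and \<open>D\<close> diagonal
  with entries \<open>X - \<mu>\<^sub>j\<close>. Since \<open>(det P)\<^sup>2 = 1\<close>, determinants give the characteristic polynomial as
  the product of the \<open>X - \<mu>\<^sub>j\<close>.
\<close>
lemma mat_eigenvalues_eigenbasis: "mat_eigenvalues A = image_mset \<mu> (mset_set UNIV)"
proof -
  let ?C = "map_matrix (\<lambda>a::real. [:a:])"
  let ?P = "?C (column_matrix b)"
  let ?M = "mat [:0, 1:] - ?C A"
  define D :: "real poly^'n^'n" where "D = (\<chi> i j. if i = j then [:- \<mu> i, 1:] else 0)"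
  have const_sum: "(\<Sum>k\<in>K. [:g k:]) = [:\<Sum>k\<in>K. g k:]" for g :: "'n \<Rightarrow> real" and K
    by (induction K rule: infinite_finite_induct) auto
  have "transpose ?P ** ?P = ?C (transpose (column_matrix b) ** column_matrix b)"
    by (simp add: vec_eq_iff matrix_matrix_mult_def transpose_def const_sum mult.commute)
  also have "\<dots> = mat 1"
    unfolding transpose_column_matrix_mult by (simp add: vec_eq_iff mat_def)
  finally have "det ?P * det ?P = 1"
    by (metis det_I det_mul det_transpose)
  then have nz: "det ?P \<noteq> 0" by auto
  have "?M ** ?P = ?P ** D"
  proof -
    have "(\<Sum>k\<in>UNIV. (mat [:0, 1:] $ i $ k - [:A $ i $ k:]) * [:b j $ k:]) =
      (\<Sum>k\<in>UNIV. [:b k $ i:] * (if k = j then [:- \<mu> k, 1:] else 0))" for i j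
    proof -
      have Ab: "(\<Sum>k\<in>UNIV. A $ i $ k * b j $ k) = \<mu> j * b j $ i"
        using arg_cong[OF eigen[of j], of "\<lambda>v. v $ i"] by (simp add: matrix_vector_mult_def)
      have "(\<Sum>k\<in>UNIV. (mat [:0, 1:] $ i $ k - [:A $ i $ k:]) * [:b j $ k:]) =
        (\<Sum>k\<in>UNIV. (if k = i then [:0, 1:] * [:b j $ k:] else 0)) -
        (\<Sum>k\<in>UNIV. [:A $ i $ k * b j $ k:])"
        by (subst sum_subtractf[symmetric], intro sum.cong)
           (auto simp: mat_def algebra_simps)
      also have "\<dots> = [:- \<mu> j * b j $ i, b j $ i:]"
        unfolding const_sum Ab by simp
      also have "\<dots> = (\<Sum>k\<in>UNIV. [:b k $ i:] * (if k = j then [:- \<mu> k, 1:] else 0))"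
        by (simp add: if_distrib[of "(*) _"] mult.commute cong: if_cong)
      finally show ?thesis .
    qed
    then show ?thesis
      by (simp add: vec_eq_iff matrix_matrix_mult_def column_matrix_def D_def)
  qed
  then have "det ?M * det ?P = det ?P * det D" by (metis det_mul)
  with nz have "mat_char_poly A = det D" by (simp add: mat_char_poly_def)
  also have "\<dots> = (\<Prod>i\<in>UNIV. [:- \<mu> i, 1:])"
    by (subst det_diagonal) (auto simp: D_def)
  finally have "mat_eigenvalues A = (\<Sum>i\<in>UNIV. {#\<mu> i#})"
    by (simp add: mat_eigenvalues_def proots_prod)
  also have "\<dots> = image_mset \<mu> (mset_set UNIV)"
    using finite_class.finite_UNIV by (induction rule: finite_induct) auto
  finally show ?thesis .
qed

end
end

text \<open>
  The eigenvalues are prescribed as a family \<open>lam\<close> indexed by numbers, and only their multiset is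
  known. Equality of multisets provides the bijection \<open>e\<close> that matches the two indexings.
\<close>
lemma symmetric_matrix_eigenbasis_enumerated:
  fixes A :: "real^'n^'n" and lam :: "nat \<Rightarrow> real"
  assumes "transpose A = A" and "mat_eigenvalues A = image_mset lam (mset_set {1..CARD('n)})"
  obtains b :: "'n \<Rightarrow> real^'n" and e where
    "\<And>i j. b i \<bullet> b j = (if i = j then 1 else 0)" "bij_betw e {1..CARD('n)} UNIV"
    "\<And>i. i \<in> {1..CARD('n)} \<Longrightarrow> A *v b (e i) = lam i *\<^sub>R b (e i)"
proof -
  obtain b :: "'n \<Rightarrow> real^'n" and \<mu> where b: "\<And>i j. b i \<bullet> b j = (if i = j then 1 else 0)"
    and eig: "\<And>i. A *v b i = \<mu> i *\<^sub>R b i"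
    using symmetric_matrix_orthonormal_eigenbasis[OF assms(1)] by blast
  obtain g where g: "bij_betw g {1..CARD('n)} (UNIV :: 'n set)"
    using finite_same_card_bij[of "{1..CARD('n)}" "UNIV :: 'n set"] by auto
  have "image_mset lam (mset_set {1..CARD('n)}) = image_mset \<mu> (mset_set UNIV)"
    using mat_eigenvalues_eigenbasis[of b A \<mu>, OF b eig] assms(2) by simp
  also have "\<dots> = image_mset (\<mu> \<circ> g) (mset_set {1..CARD('n)})"
    using g by (simp add: bij_betw_def image_mset_mset_set flip: multiset.map_comp)
  finally obtain p where p: "p permutes {1..CARD('n)}" "\<forall>x\<in>{1..CARD('n)}. lam x = (\<mu> \<circ> g) (p x)"
    using image_mset_eq_implies_permutes[of "{1..CARD('n)}" lam "\<mu> \<circ> g"] by blast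
  show thesis
  proof
    show "bij_betw (g \<circ> p) {1..CARD('n)} UNIV"
      using permutes_imp_bij[OF p(1)] g by (rule bij_betw_trans)
    show "A *v b ((g \<circ> p) i) = lam i *\<^sub>R b ((g \<circ> p) i)" if "i \<in> {1..CARD('n)}" for i
      using eig p(2) that by simp
  qed (rule b)
qed

section \<open>Generating functions and the recursion\<close>

lemma index_tuples_0: "index_tuples 0 l = (if l = 0 then {\<lambda>_. undefined} else {})"
  by (auto simp: index_tuples_def)

text \<open>
  Splitting off the last entry of a tuple; the sum of the other entries is the new index \<open>i\<close>.
\<close>
lemma sum_index_tuples_Suc:
  "(\<Sum>j\<in>index_tuples (Suc k) l. h j) =
   (\<Sum>i\<le>l. \<Sum>j\<in>index_tuples k i. h (j(Suc k := l - i)))"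
proof -
  have "(\<Sum>j\<in>index_tuples (Suc k) l. h j) =
    (\<Sum>(i, j)\<in>(SIGMA i:{..l}. index_tuples k i). h (j(Suc k := l - i)))"
  proof (rule sum.reindex_bij_witness[where
      i = "\<lambda>(i, j). j(Suc k := l - i)" and
      j = "\<lambda>j. (\<Sum>i=1..k. j i, restrict j {1..k})"])
    fix j assume j: "j \<in> index_tuples (Suc k) l"
    then have s: "(\<Sum>i=1..k. j i) + j (Suc k) = l" and e: "j \<in> {1..Suc k} \<rightarrow>\<^sub>E UNIV"
      by (auto simp: index_tuples_def)
    have "(restrict j {1..k})(Suc k := j (Suc k)) = j"
      using e by (auto simp: fun_eq_iff PiE_def extensional_def)
    then show "(case (\<Sum>i=1..k. j i, restrict j {1..k}) of (i, j) \<Rightarrow> j(Suc k := l - i)) = j"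
      using s by (metis add_diff_cancel_left' case_prod_conv)
    then show "(case (\<Sum>i=1..k. j i, restrict j {1..k}) of (i, j) \<Rightarrow> h (j(Suc k := l - i))) = h j"
      by simp
    show "(\<Sum>i=1..k. j i, restrict j {1..k}) \<in> (SIGMA i:{..l}. index_tuples k i)"
      using s by (auto simp: index_tuples_def)
  next
    fix x assume "x \<in> (SIGMA i:{..l}. index_tuples k i)"
    then obtain i j where x: "x = (i, j)" "i \<le> l" "j \<in> {1..k} \<rightarrow>\<^sub>E UNIV" "(\<Sum>i=1..k. j i) = i"
      by (auto simp: index_tuples_def)
    have s: "(\<Sum>a=1..k. (j(Suc k := l - i)) a) = i"
      unfolding x(4)[symmetric] by (intro sum.cong) auto
    have "restrict (j(Suc k := l - i)) {1..k} = j"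
      using x(3) by (auto simp: fun_eq_iff PiE_def extensional_def)
    with s show "(\<Sum>i=1..k. (case x of (i, j) \<Rightarrow> j(Suc k := l - i)) i,
        restrict (case x of (i, j) \<Rightarrow> j(Suc k := l - i)) {1..k}) = x"
      using x(1) by simp
    have "j(Suc k := l - i) \<in> {1..Suc k} \<rightarrow>\<^sub>E UNIV"
      using x(3) by (auto simp: PiE_def extensional_def)
    then show "(case x of (i, j) \<Rightarrow> j(Suc k := l - i)) \<in> index_tuples (Suc k) l"
      using s x(1,2) by (simp add: index_tuples_def)
  qed
  also have "\<dots> = (\<Sum>i\<le>l. \<Sum>j\<in>index_tuples k i. h (j(Suc k := l - i)))"
    by (subst sum.Sigma) (auto simp: finite_index_tuples)
  finally show ?thesis .
qed

text \<open>
  Sums over \<open>index_tuples\<close> occur twice: in the definition of \<open>c_tilde\<close>, and in the multinomial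
  expansion of a power of a sum. Both are coefficients of a product of power series.
\<close>
lemma fps_nth_prod_index_tuples:
  fixes F :: "nat \<Rightarrow> 'a::comm_ring_1 fps"
  shows "fps_nth (\<Prod>i=1..k. F i) l = (\<Sum>j\<in>index_tuples k l. \<Prod>i=1..k. fps_nth (F i) (j i))"
proof (induction k arbitrary: l)
  case 0
  then show ?case by (simp add: index_tuples_0)
next
  case (Suc k)
  have "(\<Sum>j\<in>index_tuples (Suc k) l. \<Prod>i=1..Suc k. fps_nth (F i) (j i)) =
    (\<Sum>i\<le>l. \<Sum>j\<in>index_tuples k i. (\<Prod>i=1..k. fps_nth (F i) (j i)) * fps_nth (F (Suc k)) (l - i))"
    unfolding sum_index_tuples_Suc by (intro sum.cong refl) (auto intro!: arg_cong2[where f="(*)"] prod.cong)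
  also have "\<dots> = (\<Sum>i\<le>l. fps_nth (\<Prod>i=1..k. F i) i * fps_nth (F (Suc k)) (l - i))"
    by (simp only: Suc.IH sum_distrib_right)
  also have "\<dots> = fps_nth (\<Prod>i=1..Suc k. F i) l"
    by (simp add: fps_mult_nth atMost_atLeast0)
  finally show ?case by simp
qed

lemma odd_double_fact_Suc: "odd_double_fact (Suc j) = (2 * j + 1) * odd_double_fact j"
  by (simp add: odd_double_fact_def)

lemma odd_double_fact_0 [simp]: "odd_double_fact 0 = 1"
  by (simp add: odd_double_fact_def)

text \<open>
  The binomial series of \<open>(1 - 2 \<phi> X) powr (- 1 / 2)\<close>.
\<close>
definition inverse_sqrt_fps :: "real \<Rightarrow> real fps" where
  "inverse_sqrt_fps \<phi> = Abs_fps (\<lambda>j. real (odd_double_fact j) / fact j * \<phi> ^ j)"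

text \<open>
  The logarithmic derivative of \<open>(1 - 2 \<phi> X) powr (- 1 / 2)\<close> is \<open>\<phi> / (1 - 2 \<phi> X)\<close>, which is half
  of the geometric series with coefficients \<open>(2 \<phi>) ^ Suc m\<close>. Both series are characterized by
  their products with \<open>1 - 2 \<phi> X\<close>.
\<close>
lemma fps_deriv_inverse_sqrt_fps:
  "fps_deriv (inverse_sqrt_fps \<phi>) =
     fps_const (1 / 2) * Abs_fps (\<lambda>m. (2 * \<phi>) ^ Suc m) * inverse_sqrt_fps \<phi>"
proof -
  let ?F = "inverse_sqrt_fps \<phi>" and ?G = "Abs_fps (\<lambda>m. (2 * \<phi>) ^ Suc m)"
  let ?L = "1 - fps_const (2 * \<phi>) * fps_X"
  have coeff: "real (Suc j) * fps_nth ?F (Suc j) = (2 * real j + 1) * \<phi> * fps_nth ?F j" for j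
    by (simp add: inverse_sqrt_fps_def odd_double_fact_Suc) (simp add: algebra_simps)
  have F: "?L * fps_deriv ?F = fps_const \<phi> * ?F"
  proof (rule fps_ext)
    fix n
    have "fps_nth (?L * fps_deriv ?F) n =
      real (Suc n) * fps_nth ?F (Suc n) - 2 * \<phi> * (real n * fps_nth ?F n)"
      by (cases n) (simp_all add: left_diff_distrib mult.assoc)
    then show "fps_nth (?L * fps_deriv ?F) n = fps_nth (fps_const \<phi> * ?F) n"
      unfolding coeff by (simp add: algebra_simps)
  qed
  have G: "?L * ?G = fps_const (2 * \<phi>)"
  proof (rule fps_ext)
    fix n
    show "fps_nth (?L * ?G) n = fps_nth (fps_const (2 * \<phi>)) n"
      by (cases n) (simp_all add: algebra_simps)
  qed
  have "?L * (fps_const (1 / 2) * ?G * ?F) = fps_const (1 / 2) * (?L * ?G) * ?F"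
    by (simp only: mult_ac)
  also have "\<dots> = ?L * fps_deriv ?F"
    unfolding F G by (simp add: mult.assoc flip: fps_const_mult)
  finally have "?L * fps_deriv ?F = ?L * (fps_const (1 / 2) * ?G * ?F)" by simp
  moreover have "?L \<noteq> 0"
  proof
    assume "?L = 0"
    then have "fps_nth ?L 0 = 0" by simp
    then show False by simp
  qed
  ultimately show ?thesis by simp
qed

lemma fps_deriv_prod_logarithmic:
  fixes F :: "'b \<Rightarrow> 'a::comm_ring_1 fps"
  assumes "\<And>i. i \<in> I \<Longrightarrow> fps_deriv (F i) = G i * F i"
  shows "fps_deriv (\<Prod>i\<in>I. F i) = (\<Sum>i\<in>I. G i) * (\<Prod>i\<in>I. F i)"
  using assms
  by (induction I rule: infinite_finite_induct) (simp_all add: algebra_simps)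

lemma c_tilde_eq_fps_nth:
  "c_tilde L lam k l = 1 / (\<Prod>i=1..k. (- lam i / L + 1) powr (1 / 2)) *
     fps_nth (\<Prod>i=1..k. inverse_sqrt_fps (phi_tilde L lam i)) l"
  by (simp only: c_tilde_def fps_nth_prod_index_tuples inverse_sqrt_fps_def fps_nth_Abs_fps)

lemma c_tilde_0: "c_tilde L lam k 0 = 1 / (\<Prod>i=1..k. (- lam i / L + 1) powr (1 / 2))"
proof -
  have "fps_nth (\<Prod>i=1..k. inverse_sqrt_fps (phi_tilde L lam i)) 0 = 1"
    by (induction k) (auto simp: inverse_sqrt_fps_def)
  then show ?thesis by (simp add: c_tilde_eq_fps_nth)
qed

text \<open>
  The generating function \<open>C\<close> of \<open>c_tilde\<close> is a product of binomial series, so its logarithmic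
  derivative is the sum of theirs, that is half of the generating function of \<open>d_tilde\<close> shifted
  by one. Comparing the coefficients of \<open>C' = (C' / C) C\<close> gives the recursion.
\<close>
lemma c_tilde_recursion:
  assumes "l \<ge> 1"
  shows "c_tilde L lam k l =
    1 / (2 * real l) * (\<Sum>j<l. d_tilde L lam k (l - j) * c_tilde L lam k j)"
proof -
  obtain m where m: "l = Suc m" using assms by (cases l) auto
  define F where "F i = inverse_sqrt_fps (phi_tilde L lam i)" for i
  define G where "G i = fps_const (1 / 2) * Abs_fps (\<lambda>m. (2 * phi_tilde L lam i) ^ Suc m)" for i
  define P where "P = (\<Prod>i=1..k. F i)"
  define C where "C = 1 / (\<Prod>i=1..k. (- lam i / L + 1) powr (1 / 2))"
  have c: "c_tilde L lam k j = C * fps_nth P j" for j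
    by (simp add: c_tilde_eq_fps_nth C_def P_def F_def)
  have d: "fps_nth (\<Sum>i=1..k. G i) j = d_tilde L lam k (Suc j) / 2" for j
    by (simp add: G_def d_tilde_def fps_sum_nth sum_divide_distrib)
  have "fps_deriv P = (\<Sum>i=1..k. G i) * P"
    unfolding P_def by (rule fps_deriv_prod_logarithmic) (simp add: F_def G_def fps_deriv_inverse_sqrt_fps)
  then have "real l * fps_nth P l = fps_nth (P * (\<Sum>i=1..k. G i)) m"
    by (metis fps_deriv_nth m mult.commute Suc_eq_plus1)
  also have "\<dots> = (\<Sum>j=0..m. fps_nth P j * (d_tilde L lam k (Suc (m - j)) / 2))"
    by (simp only: fps_mult_nth d)
  also have "\<dots> = (\<Sum>j<l. d_tilde L lam k (l - j) * fps_nth P j) / 2"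
    unfolding sum_divide_distrib m by (intro sum.cong) (auto simp: Suc_diff_le)
  finally have "fps_nth P l = 1 / (2 * real l) * (\<Sum>j<l. d_tilde L lam k (l - j) * fps_nth P j)"
    using assms by (simp add: field_simps)
  then show ?thesis
    unfolding c by (simp add: sum_distrib_left mult_ac)
qed

section \<open>Coordinates of a standard normal vector in an orthonormal basis\<close>

lemma nn_integral_lborel_translate:
  fixes c :: "'a::euclidean_space"
  assumes [measurable]: "g \<in> borel_measurable borel"
  shows "(\<integral>\<^sup>+x. g (c + x) \<partial>lborel) = (\<integral>\<^sup>+x. g x \<partial>lborel)"
  by (subst (2) lborel_distr_plus[of c, symmetric]) (simp add: nn_integral_distr)

lemma nn_integral_lborel_reflect:
  fixes c :: "'a::euclidean_space"
  assumes [measurable]: "g \<in> borel_measurable borel"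
  shows "(\<integral>\<^sup>+x. g (c - x) \<partial>lborel) = (\<integral>\<^sup>+x. g x \<partial>lborel)"
proof -
  have reflect: "lborel = distr lborel borel (\<lambda>x. c - x)"
    using lborel_affine[of "- 1" c] by (simp add: density_1)
  show ?thesis
    by (subst (2) reflect) (simp add: nn_integral_distr)
qed

text \<open>
  The usual uniqueness argument for Haar measure. For an arbitrary Borel set \<open>A\<close> and the unit ball
  \<open>B\<close>, write \<open>\<nu>\<close> for the image of Lebesgue measure \<open>\<lambda>\<close> under \<open>f\<close>. Both measures are translation
  invariant, so two translations, Tonelli and a reflection turn \<open>\<nu> A * \<lambda> B\<close> into \<open>\<lambda> A * \<nu> B\<close>. Since
  \<open>f\<close> preserves \<open>B\<close>, which has finite positive measure, \<open>\<nu> A = \<lambda> A\<close>.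
\<close>
lemma lborel_distr_orthogonal_transformation:
  fixes f :: "'a::euclidean_space \<Rightarrow> 'a"
  assumes f: "orthogonal_transformation f"
  shows "distr lborel borel f = lborel"
proof (rule measure_eqI)
  have lin: "linear f" and norm: "\<And>x. norm (f x) = norm x"
    using f by (auto simp: orthogonal_transformation)
  have fm [measurable]: "f \<in> borel_measurable borel"
    using lin by (intro borel_measurable_continuous_onI linear_continuous_on)
      (simp add: linear_conv_bounded_linear)
  fix A assume "A \<in> sets (distr lborel borel f)"
  then have A [measurable]: "A \<in> sets borel" by simp
  let ?B = "ball 0 1 :: 'a set"
  have B [measurable]: "?B \<in> sets borel" by simp
  have ind [measurable]: "indicator A \<in> borel_measurable borel" "indicator ?B \<in> borel_measurable borel"
    using A B by auto
  have "(\<integral>\<^sup>+x. indicator A (f x) \<partial>lborel) * emeasure lborel ?B =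
      (\<integral>\<^sup>+x. indicator A (f x) * (\<integral>\<^sup>+y. indicator ?B y \<partial>lborel) \<partial>lborel)"
    by (subst nn_integral_multc) auto
  also have "\<dots> = (\<integral>\<^sup>+x. \<integral>\<^sup>+y. indicator A (f x) * indicator ?B (f x + y) \<partial>lborel \<partial>lborel)"
    by (intro nn_integral_cong, subst nn_integral_cmult)
       (auto simp: nn_integral_lborel_translate[of "indicator ?B"])
  also have "\<dots> = (\<integral>\<^sup>+y. \<integral>\<^sup>+x. indicator A (f x) * indicator ?B (f x + y) \<partial>lborel \<partial>lborel)"
    by (intro lborel_pair.Fubini') measurable
  also have "\<dots> = (\<integral>\<^sup>+y. \<integral>\<^sup>+x. indicator A (f x - y) * indicator ?B (f x) \<partial>lborel \<partial>lborel)"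
  proof (rule nn_integral_cong)
    fix y
    \<comment> \<open>Translating \<open>x\<close> by \<open>c\<close> amounts to translating \<open>f x\<close> by \<open>- y\<close>.\<close>
    obtain c where c: "f c = - y"
      using orthogonal_transformation_surj[OF f] by (metis surjD)
    show "(\<integral>\<^sup>+x. indicator A (f x) * indicator ?B (f x + y) \<partial>lborel) =
        (\<integral>\<^sup>+x. indicator A (f x - y) * indicator ?B (f x) \<partial>lborel)"
      using nn_integral_lborel_translate[of "\<lambda>x. indicator A (f x) * indicator ?B (f x + y)" c]
      by (simp add: linear_add[OF lin] c)
  qed
  also have "\<dots> = (\<integral>\<^sup>+x. \<integral>\<^sup>+y. indicator A (f x - y) * indicator ?B (f x) \<partial>lborel \<partial>lborel)"
    by (intro lborel_pair.Fubini') measurable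
  also have "\<dots> = (\<integral>\<^sup>+x. emeasure lborel A * indicator ?B x \<partial>lborel)"
  proof (rule nn_integral_cong)
    fix x
    have "indicator ?B (f x) = (indicator ?B x :: ennreal)" by (simp add: norm indicator_def)
    then show "(\<integral>\<^sup>+y. indicator A (f x - y) * indicator ?B (f x) \<partial>lborel) =
        emeasure lborel A * indicator ?B x"
      by (subst nn_integral_multc) (auto simp: nn_integral_lborel_reflect[of "indicator A"])
  qed
  also have "\<dots> = emeasure lborel A * emeasure lborel ?B"
    by (subst nn_integral_cmult) auto
  finally have "(\<integral>\<^sup>+x. indicator A (f x) \<partial>lborel) * emeasure lborel ?B =
      emeasure lborel A * emeasure lborel ?B" .
  moreover have "emeasure lborel ?B \<noteq> 0" "emeasure lborel ?B \<noteq> top"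
  proof -
    have "unit_ball_vol (real DIM('a)) > 0" by simp
    moreover have "emeasure lborel ?B = ennreal (unit_ball_vol (real DIM('a)))"
      using emeasure_ball[of 1 "0::'a"] by simp
    ultimately show "emeasure lborel ?B \<noteq> 0" "emeasure lborel ?B \<noteq> top"
      by (metis ennreal_eq_0_iff not_less, simp)
  qed
  ultimately have "(\<integral>\<^sup>+x. indicator A (f x) \<partial>lborel) = emeasure lborel A"
    by (metis ennreal_mult_divide_eq)
  then show "emeasure (distr lborel borel f) A = emeasure lborel A"
    by (simp add: nn_integral_distr flip: nn_integral_indicator)
qed simp

text \<open>
  The product formula over \<open>Basis\<close>, transported to the indices of a vector type.
\<close>
lemma nn_integral_lborel_prod_vec:
  fixes g :: "'n::finite \<Rightarrow> real \<Rightarrow> ennreal"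
  assumes g: "\<And>i. g i \<in> borel_measurable borel"
  shows "(\<integral>\<^sup>+x. (\<Prod>i\<in>UNIV. g i (x $ i)) \<partial>lborel) = (\<Prod>i\<in>UNIV. \<integral>\<^sup>+t. g i t \<partial>lborel)"
proof -
  let ?ax = "\<lambda>i::'n. axis i (1::real)"
  have inj: "inj ?ax" by (rule injI) (simp add: axis_eq_axis)
  have Basis: "Basis = range ?ax" by (auto simp: Basis_vec_def)
  define h where "h b = g (inv ?ax b)" for b
  have h: "h (?ax i) = g i" for i unfolding h_def by (subst inv_f_f[OF inj]) (rule refl)
  have "(\<integral>\<^sup>+x. (\<Prod>b\<in>Basis. h b (x \<bullet> b)) \<partial>lborel) = (\<Prod>b\<in>Basis. \<integral>\<^sup>+t. h b t \<partial>lborel)"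
    by (rule nn_integral_lborel_prod) (auto simp: h_def g)
  then show ?thesis
    by (simp add: Basis prod.reindex[OF inj] h inner_axis)
qed

lemma prod_std_normal_density:
  "(\<Prod>i\<in>I. std_normal_density (f i)) = (1 / sqrt (2 * pi)) ^ card I * exp (- (\<Sum>i\<in>I. (f i)\<^sup>2) / 2)"
  by (induction I rule: infinite_finite_induct)
     (auto simp: std_normal_density_def exp_add[symmetric] field_simps mult_exp_exp)

context prob_space
begin

context
  fixes x :: "'a \<Rightarrow> real^'n" and b :: "'n \<Rightarrow> real^'n"
  assumes normal: "std_normal_vector M x"
    and orthonormal: "\<And>i j. b i \<bullet> b j = (if i = j then 1 else 0)"
begin

lemma std_normal_vector_measurable: "x \<in> borel_measurable M"
  using normal by (auto simp: std_normal_vector_def distributed_def)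

text \<open>
  The joint density depends on the norm only, so it is unchanged by the orthogonal map to the
  coordinates along \<open>b\<close>; Lebesgue measure is unchanged as well, and the integral over the product
  set factors.
\<close>
lemma emeasure_std_normal_coordinates:
  assumes A: "\<And>i. A i \<in> sets borel"
  shows "emeasure M {w \<in> space M. \<forall>i. x w \<bullet> b i \<in> A i} =
    (\<Prod>i\<in>UNIV. emeasure (density lborel (\<lambda>t. ennreal (std_normal_density t))) (A i))"
proof -
  define T where "T v = (\<chi> i. v \<bullet> b i)" for v :: "real^'n"
  have T: "orthogonal_transformation T"
    unfolding T_def by (rule orthogonal_transformation_coordinates[OF orthonormal])
  then have Tm [measurable]: "T \<in> borel_measurable borel"
    by (intro borel_measurable_continuous_onI linear_continuous_on)
       (metis orthogonal_transformation_linear linear_conv_bounded_linear)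
  note A [measurable]
  define g where "g v = (\<Prod>i\<in>UNIV. ennreal (std_normal_density (v $ i)) * indicator (A i) (v $ i))"
    for v :: "real^'n"
  have gm [measurable]: "g \<in> borel_measurable borel" unfolding g_def by measurable
  have S [measurable]: "{v. \<forall>i. v \<bullet> b i \<in> A i} \<in> sets borel"
    by measurable
  have density: "(\<Prod>i\<in>UNIV. std_normal_density (T v $ i)) = (\<Prod>i\<in>UNIV. std_normal_density (v $ i))" for v
    using orthogonal_transformation_norm[OF T, of v]
    by (simp add: prod_std_normal_density norm_eq_sqrt_inner inner_vec_def power2_eq_square)
  have "emeasure M {w \<in> space M. \<forall>i. x w \<bullet> b i \<in> A i} =
      emeasure M (x -` {v. \<forall>i. v \<bullet> b i \<in> A i} \<inter> space M)"
    by (intro arg_cong[where f="emeasure M"]) auto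
  also have "\<dots> = (\<integral>\<^sup>+v. ennreal (\<Prod>i\<in>UNIV. std_normal_density (v $ i)) *
      indicator {v. \<forall>i. v \<bullet> b i \<in> A i} v \<partial>lborel)"
    using normal S unfolding std_normal_vector_def by (intro distributed_emeasure) auto
  also have "\<dots> = (\<integral>\<^sup>+v. g (T v) \<partial>lborel)"
  proof (intro nn_integral_cong)
    fix v
    have "indicator {v. \<forall>i. v \<bullet> b i \<in> A i} v = (\<Prod>i\<in>UNIV. indicator (A i) (T v $ i) :: ennreal)"
      by (auto simp: indicator_def T_def)
    then show "ennreal (\<Prod>i\<in>UNIV. std_normal_density (v $ i)) * indicator {v. \<forall>i. v \<bullet> b i \<in> A i} v = g (T v)"
      unfolding density[of v, symmetric] g_def
      by (simp add: prod.distrib prod_ennreal normal_density_nonneg)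
  qed
  also have "\<dots> = (\<integral>\<^sup>+v. g v \<partial>distr lborel borel T)"
    by (simp add: nn_integral_distr)
  also have "\<dots> = (\<integral>\<^sup>+v. g v \<partial>lborel)"
    using lborel_distr_orthogonal_transformation[OF T] by simp
  also have "\<dots> = (\<Prod>i\<in>UNIV. \<integral>\<^sup>+t. ennreal (std_normal_density t) * indicator (A i) t \<partial>lborel)"
    unfolding g_def by (intro nn_integral_lborel_prod_vec) measurable
  also have "\<dots> = (\<Prod>i\<in>UNIV. emeasure (density lborel (\<lambda>t. ennreal (std_normal_density t))) (A i))"
    by (intro prod.cong refl, subst emeasure_density) auto
  finally show ?thesis .
qed

lemma distr_std_normal_coordinate:
  "distr M borel (\<lambda>w. x w \<bullet> b i) = density lborel (\<lambda>t. ennreal (std_normal_density t))"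
proof (rule measure_eqI)
  note std_normal_vector_measurable [measurable]
  let ?N = "density lborel (\<lambda>t. ennreal (std_normal_density t))"
  interpret N: prob_space ?N by (rule prob_space_normal_density) simp
  fix B assume "B \<in> sets (distr M borel (\<lambda>w. x w \<bullet> b i))"
  then have B [measurable]: "B \<in> sets borel" by simp
  have "emeasure (distr M borel (\<lambda>w. x w \<bullet> b i)) B =
      emeasure M {w \<in> space M. \<forall>j. x w \<bullet> b j \<in> (if j = i then B else UNIV)}"
    by (subst emeasure_distr) (auto intro!: arg_cong[where f="emeasure M"])
  also have "\<dots> = (\<Prod>j\<in>UNIV. emeasure ?N (if j = i then B else UNIV))"
    by (rule emeasure_std_normal_coordinates) auto
  also have "\<dots> = (\<Prod>j\<in>UNIV. if j = i then emeasure ?N B else 1)"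
    using N.emeasure_space_1 by (intro prod.cong) auto
  finally show "emeasure (distr M borel (\<lambda>w. x w \<bullet> b i)) B = emeasure ?N B" by simp
qed simp

lemma distributed_std_normal_coordinate:
  "distributed M lborel (\<lambda>w. x w \<bullet> b i) std_normal_density"
  unfolding distributed_def
  using distr_std_normal_coordinate[of i] std_normal_vector_measurable
  by (auto simp: cong: distr_cong)

lemma indep_vars_std_normal_coordinates:
  "indep_vars (\<lambda>_. borel) (\<lambda>i w. x w \<bullet> b i) UNIV"
proof -
  note std_normal_vector_measurable [measurable]
  let ?N = "density lborel (\<lambda>t. ennreal (std_normal_density t))"
  have "prob_space ?N" by (rule prob_space_normal_density) simp
  then interpret product_sigma_finite "\<lambda>_::'n. ?N"
    by (simp add: product_sigma_finite_def prob_space_imp_sigma_finite)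
  have "distr M (\<Pi>\<^sub>M i\<in>UNIV. borel) (\<lambda>w. \<lambda>i\<in>UNIV. x w \<bullet> b i) = (\<Pi>\<^sub>M i\<in>UNIV. ?N)"
  proof (rule PiM_eqI)
    fix A :: "'n \<Rightarrow> real set" assume "\<And>i. i \<in> UNIV \<Longrightarrow> A i \<in> sets ?N"
    then have A: "\<And>i. A i \<in> sets borel" by simp
    have "emeasure (distr M (\<Pi>\<^sub>M i\<in>UNIV. borel) (\<lambda>w. \<lambda>i\<in>UNIV. x w \<bullet> b i)) (Pi\<^sub>E UNIV A) =
        emeasure M {w \<in> space M. \<forall>i. x w \<bullet> b i \<in> A i}"
      using A by (subst emeasure_distr)
        (auto intro!: arg_cong[where f="emeasure M"] sets_PiM_I_finite)
    then show "emeasure (distr M (\<Pi>\<^sub>M i\<in>UNIV. borel) (\<lambda>w. \<lambda>i\<in>UNIV. x w \<bullet> b i)) (Pi\<^sub>E UNIV A) =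
        (\<Prod>i\<in>UNIV. emeasure ?N (A i))"
      using emeasure_std_normal_coordinates[OF A] by simp
  qed (auto intro!: sets_PiM_cong)
  then show ?thesis
    by (subst indep_vars_iff_distr_eq_PiM) (auto simp: distr_std_normal_coordinate)
qed

end
end

section \<open>Chi-square tails with an even number of degrees of freedom\<close>

text \<open>
  The volume of the ball of radius \<open>sqrt R\<close> in dimension \<open>2 p\<close>. The coordinates run over a finite
  set \<open>I\<close>, so that the dimension need not come from a type. For \<open>R = 0\<close> the ball is one point.
\<close>
lemma emeasure_PiM_sum_squares_le:
  assumes I: "finite I" "card I = 2 * p" "p > 0" and R: "R \<ge> 0"
  shows "emeasure (\<Pi>\<^sub>M i\<in>I. lborel) {f \<in> space (\<Pi>\<^sub>M i\<in>I. lborel). (\<Sum>i\<in>I. (f i)\<^sup>2) \<le> R} =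
    ennreal (pi ^ p / fact p * R ^ p)"
proof (cases "R = 0")
  case True
  interpret product_sigma_finite "\<lambda>_. lborel :: real measure" ..
  have "(\<Sum>i\<in>I. (f i)\<^sup>2) \<le> 0 \<longleftrightarrow> (\<forall>i\<in>I. f i = 0)" for f :: "_ \<Rightarrow> real"
    using sum_nonneg_eq_0_iff[OF I(1), of "\<lambda>i. (f i)\<^sup>2"] sum_nonneg[of I "\<lambda>i. (f i)\<^sup>2"] by auto
  then have eq: "{f \<in> space (\<Pi>\<^sub>M i\<in>I. lborel). (\<Sum>i\<in>I. (f i)\<^sup>2) \<le> R} = (\<Pi>\<^sub>E i\<in>I. {0::real})"
    by (auto simp: True space_PiM PiE_iff fun_eq_iff extensional_def)
  have "emeasure (\<Pi>\<^sub>M i\<in>I. lborel) {f \<in> space (\<Pi>\<^sub>M i\<in>I. lborel). (\<Sum>i\<in>I. (f i)\<^sup>2) \<le> R} =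
      (\<Prod>i\<in>I. emeasure lborel {0::real})"
    unfolding eq by (rule emeasure_PiM) (use I in auto)
  also have "\<dots> = 0" using I by (auto simp: power_0_left)
  finally show ?thesis using True I(3) by simp
next
  case False
  then have R: "R > 0" using R by simp
  have "{f \<in> space (\<Pi>\<^sub>M i\<in>I. lborel). (\<Sum>i\<in>I. (f i)\<^sup>2) \<le> R} =
      {f. sqrt (\<Sum>i\<in>I. (f i)\<^sup>2) \<le> sqrt R} \<inter> space (\<Pi>\<^sub>M i\<in>I. lborel)"
    by auto
  then show ?thesis
    using emeasure_cball_aux[OF I(1), of "sqrt R"] R I(2) unit_ball_vol_even[of p]
    by (simp add: power_mult)
qed

lemma nn_integral_exp_minus_atLeast:
  "(\<integral>\<^sup>+v. ennreal (exp (- v)) * indicator {a..} v \<partial>lborel) = ennreal (exp (- a))"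
proof -
  have "((\<lambda>v::real. - exp (- v)) \<longlongrightarrow> 0) at_top"
    using tendsto_minus[OF exp_at_bot[THEN filterlim_compose, OF filterlim_uminus_at_bot_at_top]] by simp
  then have "(\<integral>\<^sup>+v. ennreal (exp (- v)) * indicator {a..} v \<partial>lborel) = ennreal (0 - (- exp (- a)))"
    by (intro nn_integral_FTC_atLeast) (auto intro!: derivative_eq_intros)
  then show ?thesis by simp
qed

text \<open>
  Layer cake: \<open>exp (- S / 2)\<close> is the integral of \<open>exp (- v)\<close> over \<open>v \<ge> S / 2\<close>. After exchanging the
  integrals, the inner one is the volume of the ball \<open>S \<le> min u (2 v)\<close>. With \<open>a = u / 2\<close> this leaves,
  up to the factor \<open>(2 * pi) ^ p\<close>, the integral of \<open>exp (- v) * (min a v) ^ p / fact p\<close> over \<open>v \<ge> 0\<close>.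
  Its part below \<open>a\<close> is the distribution function at \<open>a\<close> of the Gamma law with shape \<open>p + 1\<close>, and its
  part above \<open>a\<close> cancels the term of order \<open>p\<close> there.
\<close>
lemma nn_integral_gaussian_ball:
  assumes I: "finite I" "card I = 2 * p" "p > 0" and u: "u \<ge> 0"
  shows "(\<integral>\<^sup>+f. ennreal (exp (- (\<Sum>i\<in>I. (f i)\<^sup>2) / 2)) * indicator {..u} (\<Sum>i\<in>I. (f i)\<^sup>2)
      \<partial>(\<Pi>\<^sub>M i\<in>I. lborel)) =
    ennreal ((2 * pi) ^ p * (1 - exp (- u / 2) * (\<Sum>m<p. (u / 2) ^ m / fact m)))"
proof -
  interpret product_sigma_finite "\<lambda>_. lborel :: real measure" ..
  interpret finite_product_sigma_finite "\<lambda>_. lborel :: real measure" I by standard (rule I(1))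
  let ?P = "\<Pi>\<^sub>M i\<in>I. (lborel :: real measure)"
  interpret pair_sigma_finite ?P "lborel :: real measure" ..
  define S where "S f = (\<Sum>i\<in>I. (f i)\<^sup>2)" for f :: "_ \<Rightarrow> real"
  have S [measurable]: "S \<in> borel_measurable ?P" unfolding S_def by measurable
  have S_nonneg: "S f \<ge> 0" for f by (simp add: S_def sum_nonneg)
  define a where "a = u / 2"
  have a: "a \<ge> 0" using u by (simp add: a_def)
  have "(\<integral>\<^sup>+f. ennreal (exp (- S f / 2)) * indicator {..u} (S f) \<partial>?P) =
      (\<integral>\<^sup>+f. \<integral>\<^sup>+v. ennreal (exp (- v)) * indicator {S f / 2..} v * indicator {..u} (S f) \<partial>lborel \<partial>?P)"
    by (intro nn_integral_cong, subst nn_integral_multc) (auto simp: nn_integral_exp_minus_atLeast)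
  also have "\<dots> = (\<integral>\<^sup>+v. \<integral>\<^sup>+f. ennreal (exp (- v)) * indicator {S f / 2..} v * indicator {..u} (S f) \<partial>?P \<partial>lborel)"
  proof (rule Fubini'[symmetric])
    have "(\<lambda>(f, v). ennreal (exp (- v)) * indicator {(f, v). S f / 2 \<le> v \<and> S f \<le> u} (f, v))
        \<in> borel_measurable (?P \<Otimes>\<^sub>M lborel)"
      by measurable
    then show "(\<lambda>(f, v). ennreal (exp (- v)) * indicator {S f / 2..} v * indicator {..u} (S f))
        \<in> borel_measurable (?P \<Otimes>\<^sub>M lborel)"
      by (rule measurable_cong[THEN iffD1, rotated]) (auto simp: indicator_def)
  qed
  also have "\<dots> = (\<integral>\<^sup>+v. ennreal (exp (- v) * (pi ^ p / fact p * (2 * min a v) ^ p)) * indicator {0..} v \<partial>lborel)"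
  proof (rule nn_integral_cong)
    fix v :: real
    show "(\<integral>\<^sup>+f. ennreal (exp (- v)) * indicator {S f / 2..} v * indicator {..u} (S f) \<partial>?P) =
        ennreal (exp (- v) * (pi ^ p / fact p * (2 * min a v) ^ p)) * indicator {0..} v"
    proof (cases "v \<ge> 0")
      case True
      then have m: "2 * min a v \<ge> 0" using a by auto
      have "(\<integral>\<^sup>+f. ennreal (exp (- v)) * indicator {S f / 2..} v * indicator {..u} (S f) \<partial>?P) =
          (\<integral>\<^sup>+f. ennreal (exp (- v)) * indicator {f \<in> space ?P. S f \<le> 2 * min a v} f \<partial>?P)"
        by (intro nn_integral_cong) (auto simp: indicator_def a_def)
      also have "\<dots> = ennreal (exp (- v)) * emeasure ?P {f \<in> space ?P. S f \<le> 2 * min a v}"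
        by (subst nn_integral_cmult_indicator) auto
      also have "emeasure ?P {f \<in> space ?P. S f \<le> 2 * min a v} = ennreal (pi ^ p / fact p * (2 * min a v) ^ p)"
        unfolding S_def by (rule emeasure_PiM_sum_squares_le[OF I m])
      also have "ennreal (exp (- v)) * \<dots> = ennreal (exp (- v) * (pi ^ p / fact p * (2 * min a v) ^ p))"
        by (rule ennreal_mult'[symmetric]) simp
      finally show ?thesis using True by simp
    next
      case False
      then have "\<not> S f / 2 \<le> v" for f using S_nonneg[of f] by linarith
      then show ?thesis using False by simp
    qed
  qed
  also have "\<dots> = (\<integral>\<^sup>+v. ennreal ((2 * pi) ^ p) *
      (ennreal (erlang_density p 1 v) * indicator {..a} v +
       ennreal (a ^ p / fact p) * (ennreal (exp (- v)) * indicator {a..} v)) \<partial>lborel)"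
  proof (rule nn_integral_cong_AE)
    have "AE v in lborel. v \<noteq> a" by (rule AE_lborel_singleton)
    then show "AE v in lborel.
      ennreal (exp (- v) * (pi ^ p / fact p * (2 * min a v) ^ p)) * indicator {0..} v =
      ennreal ((2 * pi) ^ p) * (ennreal (erlang_density p 1 v) * indicator {..a} v +
        ennreal (a ^ p / fact p) * (ennreal (exp (- v)) * indicator {a..} v))"
    proof eventually_elim
      case (elim v)
      consider "v < 0" | "0 \<le> v" "v < a" | "a < v" using elim by linarith
      then show ?case
        using a by cases
          (auto simp: erlang_density_def min_def power_mult_distrib ennreal_mult'[symmetric] mult_ac)
    qed
  qed
  also have "\<dots> = ennreal ((2 * pi) ^ p) *
      (ennreal (erlang_CDF p 1 a) + ennreal (a ^ p / fact p) * ennreal (exp (- a)))"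
    by (subst nn_integral_cmult, simp, subst nn_integral_add)
       (auto simp: nn_integral_cmult nn_integral_erlang_density nn_integral_exp_minus_atLeast)
  also have "ennreal (a ^ p / fact p) * ennreal (exp (- a)) = ennreal (a ^ p / fact p * exp (- a))"
    using a by (intro ennreal_mult'[symmetric]) simp
  also have "ennreal (erlang_CDF p 1 a) + \<dots> = ennreal (erlang_CDF p 1 a + a ^ p / fact p * exp (- a))"
    using a by (intro ennreal_plus[symmetric]) simp_all
  also have "ennreal ((2 * pi) ^ p) * \<dots> = ennreal ((2 * pi) ^ p * (erlang_CDF p 1 a + a ^ p / fact p * exp (- a)))"
    by (intro ennreal_mult'[symmetric]) simp
  also have "erlang_CDF p 1 a + a ^ p / fact p * exp (- a) = 1 - exp (- a) * (\<Sum>m<p. a ^ m / fact m)"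
    using a by (simp add: erlang_CDF_def lessThan_Suc_atMost[symmetric] sum_distrib_left mult_ac)
  finally show ?thesis by (simp add: S_def a_def)
qed

text \<open>
  Both measures agree on boxes, where the integral of the product density factors.
\<close>
lemma density_PiM_lborel:
  assumes "finite I" and g: "g \<in> borel_measurable borel" and "prob_space (density lborel g)"
  shows "density (\<Pi>\<^sub>M i\<in>I. (lborel :: real measure)) (\<lambda>f. \<Prod>i\<in>I. g (f i)) = (\<Pi>\<^sub>M i\<in>I. density lborel g)"
proof -
  interpret L: product_sigma_finite "\<lambda>_. lborel :: real measure" ..
  interpret N: product_sigma_finite "\<lambda>_. density lborel g"
    using assms(3) by (simp add: product_sigma_finite_def prob_space_imp_sigma_finite)
  note g [measurable]
  show ?thesis
  proof (rule N.PiM_eqI)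
    fix A assume "\<And>i. i \<in> I \<Longrightarrow> A i \<in> sets (density lborel g)"
    then have A [measurable]: "\<And>i. i \<in> I \<Longrightarrow> A i \<in> sets borel" by simp
    have "emeasure (density (\<Pi>\<^sub>M i\<in>I. lborel) (\<lambda>f. \<Prod>i\<in>I. g (f i))) (Pi\<^sub>E I A) =
        (\<integral>\<^sup>+f. (\<Prod>i\<in>I. g (f i)) * indicator (Pi\<^sub>E I A) f \<partial>(\<Pi>\<^sub>M i\<in>I. lborel))"
      using A assms(1) by (subst emeasure_density) (auto intro!: sets_PiM_I_finite)
    also have "\<dots> = (\<integral>\<^sup>+f. (\<Prod>i\<in>I. g (f i) * indicator (A i) (f i)) \<partial>(\<Pi>\<^sub>M i\<in>I. lborel))"
      using assms(1)
      by (intro nn_integral_cong) (auto simp: prod.distrib indicator_def space_PiM PiE_iff)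
    also have "\<dots> = (\<Prod>i\<in>I. \<integral>\<^sup>+t. g t * indicator (A i) t \<partial>lborel)"
      using assms(1) by (intro L.product_nn_integral_prod) auto
    also have "\<dots> = (\<Prod>i\<in>I. emeasure (density lborel g) (A i))"
      by (intro prod.cong refl, subst emeasure_density) auto
    finally show "emeasure (density (\<Pi>\<^sub>M i\<in>I. lborel) (\<lambda>f. \<Prod>i\<in>I. g (f i))) (Pi\<^sub>E I A) =
      (\<Prod>i\<in>I. emeasure (density lborel g) (A i))" .
  qed (use assms(1) in \<open>auto intro!: sets_PiM_cong\<close>)
qed

context prob_space
begin

text \<open>
  For an even number \<open>2 p\<close> of degrees of freedom the chi-square tail at \<open>u\<close> is a finite sum: it is the
  probability that a Poisson variable with mean \<open>u / 2\<close> is less than \<open>p\<close>.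
\<close>
lemma chi_square_even_tail:
  assumes I: "finite I" "card I = 2 * p" "p > 0" and u: "u \<ge> 0"
    and indep: "indep_vars (\<lambda>_. borel) y I"
    and normal: "\<And>i. i \<in> I \<Longrightarrow> distributed M lborel (y i) std_normal_density"
  shows "\<P>(w in M. (\<Sum>i\<in>I. (y i w)\<^sup>2) > u) = exp (- u / 2) * (\<Sum>m<p. (u / 2) ^ m / fact m)"
proof -
  let ?N = "density lborel (\<lambda>t. ennreal (std_normal_density t))"
  let ?P = "\<Pi>\<^sub>M i\<in>I. (lborel :: real measure)"
  let ?S = "\<lambda>f. \<Sum>i\<in>I. (f i)\<^sup>2"
  define T where "T = exp (- u / 2) * (\<Sum>m<p. (u / 2) ^ m / fact m)"
  have ym: "y i \<in> borel_measurable M" if "i \<in> I" for i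
    using normal[OF that] by (auto simp: distributed_def)
  then have Sm: "(\<lambda>w. \<Sum>i\<in>I. (y i w)\<^sup>2) \<in> borel_measurable M" by measurable
  have N: "distr M borel (y i) = ?N" if "i \<in> I" for i
    using normal[OF that] by (auto simp: distributed_def cong: distr_cong)
  have "I \<noteq> {}" using I by auto
  have law: "distr M (\<Pi>\<^sub>M i\<in>I. borel) (\<lambda>w. \<lambda>i\<in>I. y i w) =
      density ?P (\<lambda>f. \<Prod>i\<in>I. ennreal (std_normal_density (f i)))"
  proof -
    have "distr M (\<Pi>\<^sub>M i\<in>I. borel) (\<lambda>w. \<lambda>i\<in>I. y i w) = (\<Pi>\<^sub>M i\<in>I. distr M borel (y i))"
      using indep_vars_iff_distr_eq_PiM'[OF \<open>I \<noteq> {}\<close>, where M'="\<lambda>_. borel" and X=y] ym indep by auto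
    also have "\<dots> = (\<Pi>\<^sub>M i\<in>I. ?N)" by (intro PiM_cong refl N)
    finally show ?thesis
      by (subst density_PiM_lborel) (auto intro: I prob_space_normal_density)
  qed
  have c: "(1 / sqrt (2 * pi)) ^ card I = 1 / (2 * pi) ^ p"
    by (simp add: I(2) power_mult power_divide)
  have Sset: "{f \<in> space (\<Pi>\<^sub>M i\<in>I. borel). ?S f \<le> u} \<in> sets (\<Pi>\<^sub>M i\<in>I. (borel :: real measure))"
    by measurable
  have "emeasure M {w \<in> space M. (\<Sum>i\<in>I. (y i w)\<^sup>2) \<le> u} =
      emeasure (distr M (\<Pi>\<^sub>M i\<in>I. borel) (\<lambda>w. \<lambda>i\<in>I. y i w)) {f \<in> space (\<Pi>\<^sub>M i\<in>I. borel). ?S f \<le> u}"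
    using ym by (subst emeasure_distr[OF _ Sset])
      (auto intro!: arg_cong[where f="emeasure M"] measurable_restrict simp: space_PiM)
  also have "\<dots> = (\<integral>\<^sup>+f. (\<Prod>i\<in>I. ennreal (std_normal_density (f i))) *
      indicator {f \<in> space (\<Pi>\<^sub>M i\<in>I. borel). ?S f \<le> u} f \<partial>?P)"
    unfolding law using Sset by (subst emeasure_density) (auto cong: sets_PiM_cong)
  also have "\<dots> = (\<integral>\<^sup>+f. ennreal (1 / (2 * pi) ^ p) *
      (ennreal (exp (- ?S f / 2)) * indicator {..u} (?S f)) \<partial>?P)"
    by (intro nn_integral_cong)
       (auto simp: prod_ennreal normal_density_nonneg prod_std_normal_density c ennreal_mult'[symmetric]
          indicator_def space_PiM simp del: std_normal_density_def)
  also have "\<dots> = ennreal (1 / (2 * pi) ^ p) * ennreal ((2 * pi) ^ p * (1 - T))"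
    unfolding T_def nn_integral_gaussian_ball[OF I u, symmetric]
    by (intro nn_integral_cmult) measurable
  also have "\<dots> = ennreal (1 - T)"
    by (subst ennreal_mult'[symmetric]) auto
  finally have le: "emeasure M {w \<in> space M. (\<Sum>i\<in>I. (y i w)\<^sup>2) \<le> u} = ennreal (1 - T)" .
  have "(\<Sum>m<p. inverse (fact m) * (u / 2) ^ m) \<le> (\<Sum>m. inverse (fact m) * (u / 2) ^ m)"
    using u by (intro sum_le_suminf summable_exp) auto
  then have "(\<Sum>m<p. (u / 2) ^ m / fact m) \<le> exp (u / 2)"
    by (simp only: exp_def real_scaleR_def divide_inverse mult.commute)
  then have "T \<le> exp (- u / 2) * exp (u / 2)" unfolding T_def by (intro mult_left_mono) auto
  then have "T \<le> 1" by (simp add: mult_exp_exp)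
  with le have "\<P>(w in M. (\<Sum>i\<in>I. (y i w)\<^sup>2) \<le> u) = 1 - T"
    by (simp add: measure_def)
  moreover have "{w \<in> space M. (\<Sum>i\<in>I. (y i w)\<^sup>2) > u} =
      space M - {w \<in> space M. (\<Sum>i\<in>I. (y i w)\<^sup>2) \<le> u}"
    by auto
  moreover have "{w \<in> space M. (\<Sum>i\<in>I. (y i w)\<^sup>2) \<le> u} \<in> events"
    using Sm by measurable
  ultimately show ?thesis by (simp add: T_def prob_compl)
qed

end

section \<open>The coefficients as Gaussian expectations\<close>

lemma odd_double_fact_eq: "real (odd_double_fact j) = fact (2 * j) / (2 ^ j * fact j)"
proof (induction j)
  case (Suc j)
  have "(fact (2 * Suc j) :: real) = (2 * (real j + 1)) * ((2 * real j + 1) * fact (2 * j))"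
    by (simp add: algebra_simps)
  moreover have "2 ^ Suc j * fact (Suc j) = (2 * (real j + 1)) * (2 ^ j * fact j)"
    by (simp add: algebra_simps)
  ultimately have "fact (2 * Suc j) / (2 ^ Suc j * fact (Suc j)) =
      (2 * real j + 1) * (fact (2 * j) / (2 ^ j * fact j))"
    by (simp only: mult_divide_mult_cancel_left_if) simp
  moreover have "real (odd_double_fact (Suc j)) = (2 * real j + 1) * real (odd_double_fact j)"
    by (simp add: odd_double_fact_Suc algebra_simps)
  ultimately show ?case by (simp only: Suc.IH)
qed simp

text \<open>
  The factor \<open>exp (- (a * t\<^sup>2) / 2)\<close> turns the standard normal density into a multiple of the
  centred normal density with variance \<open>1 / (a + 1)\<close>, whose even moments are known.
\<close>
lemma gaussian_weighted_even_moment: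
  assumes a: "a \<ge> 0"
  shows "has_bochner_integral lborel
    (\<lambda>t. std_normal_density t * (exp (- (a * t\<^sup>2) / 2) * (a * t\<^sup>2) ^ j / fact j))
    (1 / (a + 1) powr (1 / 2) * (real (odd_double_fact j) / fact j * (a / (a + 1)) ^ j))"
proof -
  define s where "s = 1 / sqrt (a + 1)"
  have s: "s > 0" "s\<^sup>2 = 1 / (a + 1)" using a by (auto simp: s_def power_divide)
  have density: "std_normal_density t * exp (- (a * t\<^sup>2) / 2) = s * normal_density 0 s t" for t
  proof -
    have "- t\<^sup>2 / 2 + - (a * t\<^sup>2) / 2 = - (t - 0)\<^sup>2 / (2 * s\<^sup>2)"
      unfolding s(2) by (simp add: field_simps)
    moreover have "sqrt (2 * pi * s\<^sup>2) = sqrt (2 * pi) * s"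
      using s(1) by (simp add: real_sqrt_mult)
    ultimately show ?thesis
      unfolding normal_density_def std_normal_density_def using s(1)
      by (simp only: mult.assoc exp_add[symmetric]) simp
  qed
  have "has_bochner_integral lborel (\<lambda>t. s * a ^ j / fact j * (normal_density 0 s t * (t - 0) ^ (2 * j)))
      (s * a ^ j / fact j * (fact (2 * j) / ((2 / s\<^sup>2) ^ j * fact j)))"
    by (intro has_bochner_integral_mult_right normal_moment_even s(1))
  moreover have "s * a ^ j / fact j * (normal_density 0 s t * (t - 0) ^ (2 * j)) =
      std_normal_density t * (exp (- (a * t\<^sup>2) / 2) * (a * t\<^sup>2) ^ j / fact j)" for t
    using density[of t] by (simp add: power_mult power_mult_distrib)
  moreover have "(2 / s\<^sup>2) ^ j = 2 ^ j * (a + 1) ^ j"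
    unfolding s(2) by (simp flip: power_mult_distrib)
  then have "s * a ^ j / fact j * (fact (2 * j) / ((2 / s\<^sup>2) ^ j * fact j)) =
      1 / (a + 1) powr (1 / 2) * (real (odd_double_fact j) / fact j * (a / (a + 1)) ^ j)"
    using a by (simp add: odd_double_fact_eq powr_half_sqrt power_divide s_def mult_ac)
  ultimately show ?thesis by simp
qed

lemma fps_exp_sum:
  fixes c :: "'b \<Rightarrow> 'a::field_char_0"
  shows "(\<Prod>i\<in>I. fps_exp (c i)) = fps_exp (\<Sum>i\<in>I. c i)"
  by (induction I rule: infinite_finite_induct) (simp_all add: fps_exp_add_mult)

text \<open>
  The multinomial theorem in the form needed here, read off as the coefficients of
  \<open>exp (c\<^sub>1 X) \<cdots> exp (c\<^sub>k X) = exp ((c\<^sub>1 + \<cdots> + c\<^sub>k) X)\<close>. The exponential weight splits into one factor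
  per index, so each summand is a product over the indices.
\<close>
lemma exp_power_sum_expansion:
  fixes c :: "nat \<Rightarrow> real"
  shows "exp (- (\<Sum>i=1..k. c i) / 2) * (\<Sum>i=1..k. c i) ^ l / fact l =
    (\<Sum>j\<in>index_tuples k l. \<Prod>i=1..k. exp (- c i / 2) * c i ^ j i / fact (j i))"
proof -
  have "(\<Sum>i=1..k. c i) ^ l / fact l = fps_nth (\<Prod>i=1..k. fps_exp (c i)) l"
    by (simp add: fps_exp_sum)
  also have "\<dots> = (\<Sum>j\<in>index_tuples k l. \<Prod>i=1..k. c i ^ j i / fact (j i))"
    by (subst fps_nth_prod_index_tuples) simp
  moreover have "exp (- (\<Sum>i=1..k. c i) / 2) = (\<Prod>i=1..k. exp (- c i / 2))"
    by (simp add: exp_sum[symmetric] sum_negf sum_divide_distrib)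
  ultimately have "exp (- (\<Sum>i=1..k. c i) / 2) * ((\<Sum>i=1..k. c i) ^ l / fact l) =
    (\<Sum>j\<in>index_tuples k l. (\<Prod>i=1..k. exp (- c i / 2)) * (\<Prod>i=1..k. c i ^ j i / fact (j i)))"
    by (simp only: sum_distrib_left)
  then show ?thesis by (simp only: prod.distrib[symmetric] times_divide_eq_right)
qed

text \<open>
  The probabilistic meaning of \<open>c_tilde\<close>: expanding the power of \<open>W\<close> gives a sum over tuples of
  products of functions of single coordinates; by independence the expectation of each product
  is the product of the Gaussian moments above.
\<close>
lemma (in prob_space) c_tilde_eq_expectation:
  fixes y :: "nat \<Rightarrow> 'a \<Rightarrow> real"
  assumes indep: "indep_vars (\<lambda>_. borel) y {1..k}"
    and normal: "\<And>i. i \<in> {1..k} \<Longrightarrow> distributed M lborel (y i) std_normal_density"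
    and neg: "\<And>i. i \<in> {1..k} \<Longrightarrow> lam i \<le> 0" and L: "L > 0"
  defines "W \<equiv> \<lambda>w. \<Sum>i=1..k. - lam i / L * (y i w)\<^sup>2"
  shows "has_bochner_integral M (\<lambda>w. exp (- W w / 2) * W w ^ l / fact l) (c_tilde L lam k l)"
proof -
  define a where "a i = - lam i / L" for i
  have a: "a i \<ge> 0" if "i \<in> {1..k}" for i using neg[OF that] L by (simp add: a_def divide_nonpos_pos)
  define g where "g i n t = exp (- (a i * t\<^sup>2) / 2) * (a i * t\<^sup>2) ^ n / fact n" for i n and t :: real
  have gm [measurable]: "g i n \<in> borel_measurable borel" for i n unfolding g_def by measurable
  define m where "m i n = 1 / (a i + 1) powr (1 / 2) *
    (real (odd_double_fact n) / fact n * phi_tilde L lam i ^ n)" for i n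
  have moment: "has_bochner_integral M (\<lambda>w. g i n (y i w)) (m i n)" if "i \<in> {1..k}" for i n
  proof -
    have *: "has_bochner_integral lborel (\<lambda>t. std_normal_density t * g i n t) (m i n)"
      using gaussian_weighted_even_moment[OF a[OF that], of n]
      by (simp add: g_def m_def phi_tilde_def a_def)
    have "integrable M (\<lambda>w. g i n (y i w))"
      using distributed_integrable[OF normal[OF that], of "g i n"] *
      by (simp add: has_bochner_integral_iff normal_density_nonneg)
    moreover have "(\<integral>w. g i n (y i w) \<partial>M) = m i n"
      using distributed_integral[OF normal[OF that], of "g i n"] *
      by (simp add: has_bochner_integral_iff normal_density_nonneg)
    ultimately show ?thesis by (simp add: has_bochner_integral_iff)
  qed
  have prod: "has_bochner_integral M (\<lambda>w. \<Prod>i=1..k. g i (j i) (y i w)) (\<Prod>i=1..k. m i (j i))" for j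
  proof -
    have ind: "indep_vars (\<lambda>_. borel) (\<lambda>i w. g i (j i) (y i w)) {1..k}"
      by (rule indep_vars_compose2[OF indep]) simp
    have int: "\<And>i. i \<in> {1..k} \<Longrightarrow> integrable M (\<lambda>w. g i (j i) (y i w))"
      using moment by (simp add: has_bochner_integral_iff)
    have "(\<integral>w. (\<Prod>i=1..k. g i (j i) (y i w)) \<partial>M) = (\<Prod>i=1..k. \<integral>w. g i (j i) (y i w) \<partial>M)"
      by (rule indep_vars_lebesgue_integral[OF finite_atLeastAtMost ind int])
    also have "\<dots> = (\<Prod>i=1..k. m i (j i))"
      using moment by (intro prod.cong refl) (simp add: has_bochner_integral_iff)
    finally show ?thesis
      using indep_vars_integrable[OF finite_atLeastAtMost ind int] by (simp add: has_bochner_integral_iff)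
  qed
  have "has_bochner_integral M (\<lambda>w. \<Sum>j\<in>index_tuples k l. \<Prod>i=1..k. g i (j i) (y i w))
      (\<Sum>j\<in>index_tuples k l. \<Prod>i=1..k. m i (j i))"
    by (intro has_bochner_integral_sum prod)
  moreover have "(\<Sum>j\<in>index_tuples k l. \<Prod>i=1..k. g i (j i) (y i w)) =
      exp (- W w / 2) * W w ^ l / fact l" for w
    unfolding W_def g_def a_def by (rule exp_power_sum_expansion[symmetric])
  moreover have "(\<Sum>j\<in>index_tuples k l. \<Prod>i=1..k. m i (j i)) = c_tilde L lam k l"
    unfolding c_tilde_def m_def a_def
    by (simp add: prod.distrib prod_dividef sum_distrib_left)
  ultimately show ?thesis by simp
qed

section \<open>The tail bound\<close>

text \<open>
  The chi-square tail at \<open>s + x\<close> separated, by the binomial theorem, into powers of \<open>s\<close> and the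
  functions of \<open>x\<close> whose expectations are the numbers \<open>c_tilde\<close>.
\<close>
lemma poisson_tail_expansion:
  fixes s x :: real
  shows "exp (- (s + x) / 2) * (\<Sum>m<p. ((s + x) / 2) ^ m / fact m) =
    exp (- s / 2) * (\<Sum>m<p. 1 / 2 ^ m * (\<Sum>l\<le>m.
      (exp (- x / 2) * x ^ l / fact l) / fact (m - l) * s ^ (m - l)))"
proof -
  have "((s + x) / 2) ^ m / fact m = 1 / 2 ^ m * (\<Sum>l\<le>m. x ^ l / fact l / fact (m - l) * s ^ (m - l))" for m
  proof -
    have "(s + x) ^ m = (\<Sum>l\<le>m. real (m choose l) * x ^ l * s ^ (m - l))"
      using binomial_ring[of x s m] by (simp add: add.commute)
    also have "\<dots> = (\<Sum>l\<le>m. fact m * (x ^ l / fact l / fact (m - l) * s ^ (m - l)))"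
      by (intro sum.cong refl) (simp add: binomial_fact)
    also have "\<dots> = fact m * (\<Sum>l\<le>m. x ^ l / fact l / fact (m - l) * s ^ (m - l))"
      by (simp only: sum_distrib_left)
    finally show ?thesis by (simp add: power_divide)
  qed
  moreover have "exp (- (s + x) / 2) = exp (- s / 2) * exp (- x / 2)"
    by (simp add: mult_exp_exp add_divide_distrib)
  ultimately show ?thesis
    by (simp add: sum_distrib_left mult_ac)
qed

text \<open>
  Conditioning on \<open>W\<close>: if \<open>H\<close> gives the tail of \<open>U\<close> beyond \<open>s + W\<close> for a fixed value of \<open>W\<close>, then, by
  independence, averaging \<open>H\<close> over \<open>W\<close> gives the probability with both variables random.
\<close>
lemma (in prob_space) indep_var_prob_less:
  fixes W U :: "'a \<Rightarrow> real"
  assumes indep: "indep_var borel W borel U"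
    and tail: "\<And>w. w \<in> space M \<Longrightarrow> \<P>(w' in M. U w' > s + W w) = H (W w)"
    and int: "integrable M (\<lambda>w. H (W w))"
  shows "\<P>(w in M. U w > s + W w) = (\<integral>w. H (W w) \<partial>M)"
proof -
  have W [measurable]: "W \<in> borel_measurable M" and U [measurable]: "U \<in> borel_measurable M"
    using indep_var_rv1[OF indep] indep_var_rv2[OF indep] by auto
  interpret DW: prob_space "distr M borel W" by (rule prob_space_distr) (rule W)
  interpret DU: prob_space "distr M borel U" by (rule prob_space_distr) (rule U)
  define Q where "Q = {z \<in> space (borel \<Otimes>\<^sub>M borel). snd z > s + (fst z :: real)}"
  have Q [measurable]: "Q \<in> sets (borel \<Otimes>\<^sub>M borel)" unfolding Q_def by measurable
  have "emeasure M {w \<in> space M. U w > s + W w} =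
      emeasure (distr M (borel \<Otimes>\<^sub>M borel) (\<lambda>w. (W w, U w))) Q"
    by (subst emeasure_distr[OF _ Q])
       (auto intro!: arg_cong[where f="emeasure M"] simp: Q_def space_pair_measure)
  also have "\<dots> = emeasure (distr M borel W \<Otimes>\<^sub>M distr M borel U) Q"
    using indep by (simp add: indep_var_distribution_eq)
  also have "\<dots> = (\<integral>\<^sup>+a. emeasure (distr M borel U) (Pair a -` Q) \<partial>distr M borel W)"
    by (rule DU.emeasure_pair_measure_alt) (simp cong: sets_pair_measure_cong)
  also have "\<dots> = (\<integral>\<^sup>+w. emeasure (distr M borel U) (Pair (W w) -` Q) \<partial>M)"
  proof (rule nn_integral_distr[OF W])
    have "Q \<in> sets (borel \<Otimes>\<^sub>M distr M borel U)" by (simp cong: sets_pair_measure_cong)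
    then show "(\<lambda>a. emeasure (distr M borel U) (Pair a -` Q)) \<in> borel_measurable (distr M borel W)"
      using DU.measurable_emeasure_Pair by simp
  qed
  also have "\<dots> = (\<integral>\<^sup>+w. ennreal (H (W w)) \<partial>M)"
  proof (rule nn_integral_cong)
    fix w assume w: "w \<in> space M"
    have "emeasure (distr M borel U) (Pair (W w) -` Q) = emeasure M {w' \<in> space M. U w' > s + W w}"
      by (subst emeasure_distr)
         (auto intro!: arg_cong[where f="emeasure M"] simp: Q_def space_pair_measure vimage_def)
    then show "emeasure (distr M borel U) (Pair (W w) -` Q) = ennreal (H (W w))"
      using tail[OF w] by (simp add: emeasure_eq_measure)
  qed
  also have "\<dots> = ennreal (\<integral>w. H (W w) \<partial>M)"
    using int by (intro nn_integral_eq_integral) (auto simp: tail[symmetric])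
  finally have "emeasure M {w \<in> space M. U w > s + W w} = ennreal (\<integral>w. H (W w) \<partial>M)" .
  moreover have "(\<integral>w. H (W w) \<partial>M) \<ge> 0"
    by (intro integral_nonneg_AE) (auto simp: tail[symmetric])
  ultimately show ?thesis by (simp add: measure_def)
qed

lemma (in prob_space) indep_vars_reindex:
  assumes indep: "indep_vars M' X I" and inj: "inj_on f J" and sub: "f ` J \<subseteq> I"
  shows "indep_vars (\<lambda>j. M' (f j)) (\<lambda>j. X (f j)) J"
proof -
  have "disjoint_family_on (\<lambda>j. {f j}) J"
    using inj by (auto simp: disjoint_family_on_def inj_on_def)
  then have "indep_vars (\<lambda>j. PiM {f j} M') (\<lambda>j w. restrict (\<lambda>i. X i w) {f j}) J"
    using sub by (intro indep_vars_restrict[OF indep]) auto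
  then have "indep_vars (\<lambda>j. M' (f j)) (\<lambda>j w. restrict (\<lambda>i. X i w) {f j} (f j)) J"
    by (rule indep_vars_compose2[where Y="\<lambda>j h. h (f j)"]) simp
  then show ?thesis by simp
qed

text \<open>
  An exact formula for the tail of the random variable that dominates the quadratic form. Given
  \<open>W\<close>, the tail is that of a chi-square variable with \<open>2 p\<close> degrees of freedom at \<open>s + W\<close>, and its
  expansion is averaged term by term.
\<close>
lemma (in prob_space) chi_square_minus_negative_part_tail:
  fixes y :: "nat \<Rightarrow> 'a \<Rightarrow> real"
  assumes indep: "indep_vars (\<lambda>_. borel) y K"
    and normal: "\<And>i. i \<in> K \<Longrightarrow> distributed M lborel (y i) std_normal_density"
    and K: "{1..k} \<subseteq> K" "I \<subseteq> K" "{1..k} \<inter> I = {}"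
    and I: "finite I" "card I = 2 * p" "p > 0"
    and neg: "\<And>i. i \<in> {1..k} \<Longrightarrow> lam i \<le> 0" and L: "L > 0" and s: "s \<ge> 0"
  defines "W \<equiv> \<lambda>w. \<Sum>i=1..k. - lam i / L * (y i w)\<^sup>2"
  shows "\<P>(w in M. (\<Sum>i\<in>I. (y i w)\<^sup>2) > s + W w) =
    exp (- s / 2) * (\<Sum>m<p. 1 / 2 ^ m *
      (\<Sum>l\<le>m. c_tilde L lam k l / fact (m - l) * s ^ (m - l)))"
proof -
  define H where "H x = exp (- (s + x) / 2) * (\<Sum>m<p. ((s + x) / 2) ^ m / fact m)" for x :: real
  have W_nonneg: "W w \<ge> 0" for w
    unfolding W_def using neg L by (intro sum_nonneg mult_nonneg_nonneg) (auto simp: divide_nonpos_pos)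
  have "indep_var borel ((\<lambda>f. \<Sum>i=1..k. - lam i / L * (f i)\<^sup>2) \<circ> (\<lambda>w. restrict (\<lambda>i. y i w) {1..k}))
      borel ((\<lambda>f. \<Sum>i\<in>I. (f i)\<^sup>2) \<circ> (\<lambda>w. restrict (\<lambda>i. y i w) I))"
    by (rule indep_var_compose[OF indep_var_restrict[OF indep K(3,1,2)]]) measurable
  then have ind: "indep_var borel W borel (\<lambda>w. \<Sum>i\<in>I. (y i w)\<^sup>2)"
    by (simp add: comp_def W_def)
  have tail: "\<P>(w' in M. (\<Sum>i\<in>I. (y i w')\<^sup>2) > s + W w) = H (W w)" for w
    unfolding H_def using s W_nonneg[of w] K(2)
    by (intro chi_square_even_tail[OF I _ indep_vars_subset[OF indep K(2)] normal]) auto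
  have moment: "has_bochner_integral M (\<lambda>w. exp (- W w / 2) * W w ^ l / fact l) (c_tilde L lam k l)" for l
    unfolding W_def using K(1)
    by (intro c_tilde_eq_expectation indep_vars_subset[OF indep] normal neg L) auto
  have "has_bochner_integral M (\<lambda>w. H (W w)) (exp (- s / 2) * (\<Sum>m<p. 1 / 2 ^ m *
      (\<Sum>l\<le>m. c_tilde L lam k l / fact (m - l) * s ^ (m - l))))"
    unfolding H_def poisson_tail_expansion
    by (intro has_bochner_integral_mult_right has_bochner_integral_sum has_bochner_integral_mult_left
        has_bochner_integral_divide_zero moment)
  then show ?thesis
    using indep_var_prob_less[OF ind tail] by (simp add: has_bochner_integral_iff)
qed

theorem proposition8:
  fixes A :: "real^'n^'n" and lam :: "nat \<Rightarrow> real" and k :: nat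
    and M :: "'w measure" and x :: "'w \<Rightarrow> real^'n"
  assumes symmetric: "transpose A = A"
    and rank_ge: "rank A \<ge> 3"
    and eigenvalues: "mat_eigenvalues A = image_mset lam (mset_set {1..CARD('n)})"
    and max_pos: "lambda_max A > 0"
    and k_range: "1 \<le> k" "k \<le> CARD('n) - 1"
    and increasing: "mono_on {1..k} lam"
    and smallest: "\<forall>i\<in>{1..k}. \<forall>j\<in>{k+1..CARD('n)}. lam i \<le> lam j"
    and negative: "lam k < 0"
    and even_diff: "even (int (rank A) - int k)"
    and prob: "prob_space M"
    and normal: "std_normal_vector M x"
  shows "(\<forall>t>0. t + trace A \<ge> 0 \<longrightarrow>
           measure M {w \<in> space M. x w \<bullet> (A *v x w) - trace A > t}
           \<le> exp (- (t + trace A) / (2 * lambda_max A)) *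
             (\<Sum>m<(rank A - k) div 2. 1 / 2 ^ m *
               (\<Sum>l\<le>m. c_tilde (lambda_max A) lam k l / fact (m - l) *
                 ((t + trace A) / lambda_max A) ^ (m - l))))
       \<and> c_tilde (lambda_max A) lam k 0
           = 1 / (\<Prod>i=1..k. (- lam i / lambda_max A + 1) powr (1 / 2))
       \<and> (\<forall>l\<ge>1. c_tilde (lambda_max A) lam k l
           = 1 / (2 * real l) *
             (\<Sum>j<l. d_tilde (lambda_max A) lam k (l - j) * c_tilde (lambda_max A) lam k j))"
proof -
  interpret prob_space M by (rule prob)
  define n where "n = CARD('n)"
  define L where "L = lambda_max A"
  define s where "s t = (t + trace A) / L" for t
  have L: "L > 0" using max_pos by (simp add: L_def)
  have k_n: "k < n" using k_range zero_less_card_finite[where 'a='n] by (auto simp: n_def)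
  obtain b :: "'n \<Rightarrow> real^'n" and e where
    orthonormal: "\<And>i j. b i \<bullet> b j = (if i = j then 1 else 0)" and
    e: "bij_betw e {1..n} UNIV" and
    eigen: "\<And>i. i \<in> {1..n} \<Longrightarrow> A *v b (e i) = lam i *\<^sub>R b (e i)"
    using symmetric_matrix_eigenbasis_enumerated[OF symmetric eigenvalues] unfolding n_def by blast
  define \<mu> where "\<mu> c = lam (inv_into {1..n} e c)" for c
  have inj_e: "inj_on e {1..n}" and range_e: "e ` {1..n} = UNIV" using e by (auto simp: bij_betw_def)
  have mu_e: "\<mu> (e i) = lam i" if "i \<in> {1..n}" for i
    using that inj_e by (simp add: \<mu>_def)
  have eigen_mu: "A *v b c = \<mu> c *\<^sub>R b c" for c
  proof -
    have "c \<in> e ` {1..n}" using range_e by simp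
    then show ?thesis using eigen mu_e by auto
  qed
  define y where "y i w = x w \<bullet> b (e i)" for i w
  have form: "x w \<bullet> (A *v x w) = (\<Sum>i\<in>{1..n}. lam i * (y i w)\<^sup>2)" for w
  proof -
    have "x w \<bullet> (A *v x w) = (\<Sum>c\<in>e ` {1..n}. \<mu> c * (x w \<bullet> b c)\<^sup>2)"
      using quadratic_form_eigenbasis[of b A \<mu> "x w", OF orthonormal eigen_mu] by (simp only: range_e)
    also have "\<dots> = (\<Sum>i\<in>{1..n}. \<mu> (e i) * (x w \<bullet> b (e i))\<^sup>2)"
      by (simp only: sum.reindex[OF inj_e] comp_def)
    also have "\<dots> = (\<Sum>i\<in>{1..n}. lam i * (y i w)\<^sup>2)"
      by (intro sum.cong) (simp_all add: mu_e y_def)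
    finally show ?thesis .
  qed
  have indep: "indep_vars (\<lambda>_. borel) y {1..n}"
    unfolding y_def[abs_def]
    by (rule indep_vars_reindex[OF indep_vars_std_normal_coordinates[OF normal orthonormal] inj_e]) simp
  have y_normal: "distributed M lborel (y i) std_normal_density" for i
    unfolding y_def[abs_def] by (rule distributed_std_normal_coordinate[OF normal orthonormal])
  have ym [measurable]: "y i \<in> borel_measurable M" for i
    using y_normal[of i] by (auto simp: distributed_def)
  have eig_set: "set_mset (mat_eigenvalues A) = lam ` {1..n}"
    unfolding eigenvalues n_def by simp
  have lam_le: "lam i \<le> L" if "i \<in> {1..n}" for i
    using that unfolding L_def lambda_max_def eig_set by (intro Max_ge) auto
  have "L \<in> lam ` {1..n}"
    unfolding L_def lambda_max_def eig_set using k_n by (intro Max_in) auto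
  then obtain i0 where i0: "i0 \<in> {1..n}" "lam i0 = L" by auto
  have neg: "lam i < 0" if "i \<in> {1..k}" for i
    using mono_onD[OF increasing, of i k] that negative by auto
  \<comment> \<open>The remaining nonzero eigenvalues, which may still include negative ones.\<close>
  define I where "I = {i \<in> {k+1..n}. lam i \<noteq> 0}"
  have "i0 \<notin> {1..k}" using i0 L neg[of i0] by force
  then have "i0 \<in> I" using i0 L by (auto simp: I_def)
  have "{c. \<mu> c \<noteq> 0} = {c \<in> e ` {1..n}. \<mu> c \<noteq> 0}"
    by (simp only: range_e UNIV_I simp_thms)
  also have "\<dots> = e ` {i \<in> {1..n}. \<mu> (e i) \<noteq> 0}" by blast
  also have "{i \<in> {1..n}. \<mu> (e i) \<noteq> 0} = {i \<in> {1..n}. lam i \<noteq> 0}"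
    using mu_e by (intro Collect_cong) auto
  finally have nonzero: "{c. \<mu> c \<noteq> 0} = e ` {i \<in> {1..n}. lam i \<noteq> 0}" .
  have "{1..n} = {1..k} \<union> {k+1..n}" using k_n by auto
  moreover have "\<forall>i\<in>{1..k}. lam i \<noteq> 0" using neg by force
  ultimately have split: "{i \<in> {1..n}. lam i \<noteq> 0} = {1..k} \<union> I"
    unfolding I_def by blast
  have "rank A = card {c. \<mu> c \<noteq> 0}"
    by (rule rank_eq_card_nonzero_eigenvalues[OF orthonormal eigen_mu])
  also have "\<dots> = card {i \<in> {1..n}. lam i \<noteq> 0}"
    unfolding nonzero by (intro card_image inj_on_subset[OF inj_e]) blast
  also have "\<dots> = card {1..k} + card I"
    unfolding split by (intro card_Un_disjoint) (auto simp: I_def)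
  also have "\<dots> = k + card I" by simp
  finally have rank: "rank A = k + card I" .
  define p where "p = (rank A - k) div 2"
  have cardI: "card I = 2 * p" using even_diff by (simp add: p_def rank)
  \<comment> \<open>An eigenvalue equal to \<open>L > 0\<close> lies outside the first \<open>k\<close>, so the number of degrees of freedom is not zero.\<close>
  moreover have "card I \<noteq> 0" using \<open>i0 \<in> I\<close> by (auto simp: I_def)
  ultimately have p: "p > 0" by simp
  have bound: "measure M {w \<in> space M. x w \<bullet> (A *v x w) - trace A > t} \<le>
      exp (- s t / 2) * (\<Sum>m<p. 1 / 2 ^ m *
        (\<Sum>l\<le>m. c_tilde L lam k l / fact (m - l) * s t ^ (m - l)))"
    if t: "t + trace A \<ge> 0" for t
  proof -
    let ?W = "\<lambda>w. \<Sum>i=1..k. - lam i / L * (y i w)\<^sup>2"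
    have s: "s t \<ge> 0" using t L by (simp add: s_def)
    \<comment> \<open>The only loss in the bound: each eigenvalue with index in \<open>I\<close> is raised to \<open>L\<close>.\<close>
    have dominated: "x w \<bullet> (A *v x w) \<le> L * ((\<Sum>i\<in>I. (y i w)\<^sup>2) - ?W w)" for w
    proof -
      have "x w \<bullet> (A *v x w) = (\<Sum>i=1..k. lam i * (y i w)\<^sup>2) + (\<Sum>i=k+1..n. lam i * (y i w)\<^sup>2)"
        unfolding form using k_n by (subst sum.union_disjoint[symmetric]) (auto intro!: sum.cong)
      also have "(\<Sum>i=k+1..n. lam i * (y i w)\<^sup>2) = (\<Sum>i\<in>I. lam i * (y i w)\<^sup>2)"
        by (rule sum.mono_neutral_right) (auto simp: I_def)
      also have "(\<Sum>i=1..k. lam i * (y i w)\<^sup>2) + \<dots> \<le>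
          (\<Sum>i=1..k. lam i * (y i w)\<^sup>2) + (\<Sum>i\<in>I. L * (y i w)\<^sup>2)"
        using lam_le by (intro add_left_mono sum_mono mult_right_mono) (auto simp: I_def)
      also have "(\<Sum>i=1..k. lam i * (y i w)\<^sup>2) = - (L * ?W w)"
        using L by (simp add: sum_distrib_left sum_negf)
      also have "- (L * ?W w) + (\<Sum>i\<in>I. L * (y i w)\<^sup>2) = L * ((\<Sum>i\<in>I. (y i w)\<^sup>2) - ?W w)"
        by (simp only: right_diff_distrib sum_distrib_left[symmetric])
      finally show ?thesis .
    qed
    have "measure M {w \<in> space M. x w \<bullet> (A *v x w) - trace A > t} \<le>
        \<P>(w in M. (\<Sum>i\<in>I. (y i w)\<^sup>2) > s t + ?W w)"
    proof (rule finite_measure_mono)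
      show "{w \<in> space M. x w \<bullet> (A *v x w) - trace A > t} \<subseteq>
          {w \<in> space M. (\<Sum>i\<in>I. (y i w)\<^sup>2) > s t + ?W w}"
      proof safe
        fix w assume "x w \<bullet> (A *v x w) - trace A > t"
        then have "L * s t < L * ((\<Sum>i\<in>I. (y i w)\<^sup>2) - ?W w)"
          using dominated[of w] L by (simp add: s_def)
        then have "s t < (\<Sum>i\<in>I. (y i w)\<^sup>2) - ?W w"
          using L by (simp only: mult_less_cancel_left_pos)
        then show "(\<Sum>i\<in>I. (y i w)\<^sup>2) > s t + ?W w" by linarith
      qed
    qed measurable
    also have "\<dots> = exp (- s t / 2) * (\<Sum>m<p. 1 / 2 ^ m *
        (\<Sum>l\<le>m. c_tilde L lam k l / fact (m - l) * s t ^ (m - l)))"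
      using k_n neg
      by (intro chi_square_minus_negative_part_tail[OF indep y_normal _ _ _ _ cardI p _ L s])
         (auto simp: I_def less_imp_le)
    finally show ?thesis .
  qed
  have "- (t + trace A) / (2 * L) = - s t / 2" for t
    using L by (simp add: s_def field_simps)
  then show ?thesis
    using bound c_tilde_0 c_tilde_recursion unfolding p_def s_def L_def by simp
qed

end
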